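(* Let $\mathcal{D}$ be a positive integer-valued random variable that is regularly varying with exponent $\gamma>1$, with probability density function $f$ and size-biased density $f^*$, and let $\{G_n\}_{n\ge1}$ be a sequence of graphs generated by the erased configuration model (ECM) with $\mathbf{D}_n=\mathtt{IID}(\mathcal{D})$. Then, for any $\delta>0$ and $k$ such that $f^*(k)>0$, $$\lim_{n\to\infty}\mathbb{P}\left(\left|\widehat\Theta_n(k)-\mathbb{E}[F^*(\mathcal{D}^* )]\right|\mathbf{1}\{f_n(k)>0\}>\delta\right)=0.$$
   Context: $\mathcal{D}$ is regularly varying with exponent $\gamma$ if $\mathbb{P}(\mathcal{D}=k)=l(k)k^{-\gamma-1}$, $k=1,2,\dots$, where $l$ is slowly varying ($\lim_{x\to\infty}l(\lambda x)/l(x)=1$ for all $\lambda>0$) and eventually monotone. The size-biased density is $f^*(k)=kf(k)/\mathbb{E}[\mathcal{D}]$, $F^*$ is its cumulative distribution function, and $\mathcal{D}^*$ is a random variable with distribution function $F^*$; thus $\mathbb{E}[F^*(\mathcal{D}^* )]=\sum_{\ell>0}f^*(\ell)F^*(\ell)$. $\mathbf{D}_n=(D_1,\dots,D_n)=\mathtt{IID}(\mathcal{D})$ means: $D_1,\dots,D_{n-1},d_n$ are i.i.d. copies of $\mathcal{D}$, and $D_n=d_n+\mathbf{1}\{\sum_{i=1}^{n-1}D_i+d_n\text{ is odd}\}$, so that $L_n=\sum_{i=1}^nD_i$ is even. $f_n(k)=\frac1n\sum_{i=1}^n\mathbf{1}\{D_i=k\}$ is the empirical density of these (pre-erasure) degrees.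 Configuration model (CM): given $\mathbf{D}_n$, assign $D_i$ stubs (half-edges) to node $i$ and pair the $L_n$ stubs uniformly at random, giving a (possibly multi-)graph on nodes $1,\dots,n$. The erased configuration model (ECM) is obtained from the CM graph by removing all self-loops and replacing multiple edges between two nodes by a single edge. $G_{ij}$ is the number of edges between $i$ and $j\ne i$ in the CM graph; in the ECM graph $\widehat G_{ij}=\mathbf{1}\{G_{ij}\ge1\}$ for $i\ne j$, $\widehat G_{ii}=0$, $\widehat D_i=\sum_j\widehat G_{ij}$, $\widehat L_n=\sum_i\widehat D_i$. $\widehat f_n(k)=\frac1n\sum_{i=1}^n\mathbf{1}\{\widehat D_i=k\}$, $\widehat f_n^*(k)=\frac1{\widehat L_n}\sum_{i=1}^nk\,\mathbf{1}\{\widehat D_i=k\}$, $\widehat F_n^*(\ell)=\frac1{\widehat L_n}\sum_{i=1}^n\widehat D_i\mathbf{1}\{\widehat D_i\le\ell\}$, $\widehat h_n(k,\ell)=\frac1{\widehat L_n}\sum_{i,j=1}^n\widehat G_{ij}\mathbf{1}\{\widehat D_i=k,\widehat D_j=\ell\}$; the average nearest neighbor rank in the ECM is $\widehat\Theta_n(k)=\mathbf{1}\{\widehat f_n(k)>0\}\frac{\sum_{\ell>0}\widehat h_n(k,\ell)\widehat F_n^*(\ell)}{\widehat f_n^*(k)}$ (set to $0$ if $\widehat f_n(k)=0$). *)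

theory Defs
  imports "HOL-Probability.Probability"
begin

section \<open>Regularly varying degree distributions\<close>

definition slowly_varying :: "(real \<Rightarrow> real) \<Rightarrow> bool" where
  "slowly_varying l \<longleftrightarrow> (\<forall>c>0. ((\<lambda>x. l (c * x) / l x) \<longlongrightarrow> 1) at_top)"

definition eventually_monotone :: "(real \<Rightarrow> real) \<Rightarrow> bool" where
  "eventually_monotone l \<longleftrightarrow> (\<exists>x0. mono_on {x0..} l \<or> antimono_on {x0..} l)"

definition regularly_varying :: "nat pmf \<Rightarrow> real \<Rightarrow> bool" where
  "regularly_varying D \<gamma> \<longleftrightarrow>
     (\<exists>l. slowly_varying l \<and> eventually_monotone l \<and>
          (\<forall>k\<ge>1. pmf D k = l (real k) * real k powr (- \<gamma> - 1)))"

definition size_biased_density :: "nat pmf \<Rightarrow> nat \<Rightarrow> real" where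
  "size_biased_density D k = real k * pmf D k / measure_pmf.expectation D real"

definition size_biased_cdf :: "nat pmf \<Rightarrow> nat \<Rightarrow> real" where
  "size_biased_cdf D k = (\<Sum>j\<le>k. size_biased_density D j)"

text \<open>The law of the size-biased variable. It is meaningful only if \<open>D\<close> has finite, nonzero
  mean; see \<open>pmf_size_biased\<close> below.\<close>

definition size_biased_pmf :: "nat pmf \<Rightarrow> nat pmf" where
  "size_biased_pmf D = embed_pmf (size_biased_density D)"

lemma pmf_size_biased:
  assumes "integrable (measure_pmf D) real" and "measure_pmf.expectation D real > 0"
  shows "pmf (size_biased_pmf D) k = size_biased_density D k"
proof -
  let ?m = "measure_pmf.expectation D real"
  have "(\<integral>\<^sup>+x. ennreal (size_biased_density D x) \<partial>count_space UNIV) =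
        (\<integral>\<^sup>+x. ennreal (pmf D x) * ennreal (real x / ?m) \<partial>count_space UNIV)"
    using assms(2)
    by (intro nn_integral_cong) (simp add: size_biased_density_def ennreal_mult'[symmetric] mult_ac)
  also have "\<dots> = (\<integral>\<^sup>+x. ennreal (real x / ?m) \<partial>measure_pmf D)"
    by (simp add: nn_integral_measure_pmf)
  also have "\<dots> = ennreal (\<integral>x. real x / ?m \<partial>measure_pmf D)"
    using assms by (intro nn_integral_eq_integral) auto
  also have "(\<integral>x. real x / ?m \<partial>measure_pmf D) = 1"
    using assms by simp
  finally have "(\<integral>\<^sup>+x. ennreal (size_biased_density D x) \<partial>count_space UNIV) = 1"
    by simp
  then show ?thesis
    unfolding size_biased_pmf_def using assms(2)
    by (intro pmf_embed_pmf) (auto simp: size_biased_density_def)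
qed


section \<open>The configuration model\<close>

text \<open>Nodes are \<open>1, \<dots>, n\<close>; a degree sequence is a function of which only the values on
  \<open>{1..n}\<close> matter.\<close>

definition total_degree :: "nat \<Rightarrow> (nat \<Rightarrow> nat) \<Rightarrow> nat" where
  "total_degree n d = (\<Sum>i=1..n. d i)"

definition fix_parity :: "nat \<Rightarrow> (nat \<Rightarrow> nat) \<Rightarrow> (nat \<Rightarrow> nat)" where
  "fix_parity n d = d(n := d n + of_bool (odd (total_degree n d)))"

definition iid_degrees :: "nat pmf \<Rightarrow> nat \<Rightarrow> (nat \<Rightarrow> nat) pmf" where
  "iid_degrees D n = map_pmf (fix_parity n) (Pi_pmf {1..n} 0 (\<lambda>_. D))"

text \<open>The stub \<open>(i, s)\<close> is the \<open>s\<close>-th half-edge at node \<open>i\<close>.\<close>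

definition stubs :: "nat \<Rightarrow> (nat \<Rightarrow> nat) \<Rightarrow> (nat \<times> nat) set" where
  "stubs n d = (SIGMA i:{1..n}. {..<d i})"

definition pairings :: "'a set \<Rightarrow> 'a set set set" where
  "pairings S = {P. partition_on S P \<and> (\<forall>e\<in>P. card e = 2)}"

text \<open>A realisation of the configuration model is a degree sequence together with a pairing of
  its stubs.\<close>

definition configuration_model ::
  "nat pmf \<Rightarrow> nat \<Rightarrow> ((nat \<Rightarrow> nat) \<times> (nat \<times> nat) set set) pmf" where
  "configuration_model D n =
     do { d \<leftarrow> iid_degrees D n;
          P \<leftarrow> pmf_of_set (pairings (stubs n d));
          return_pmf (d, P) }"

text \<open>The uniform distribution on pairings is well defined: the set of pairings is finite, and it is
  nonempty because the number of stubs is almost surely even.\<close>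

lemma finite_pairings: "finite S \<Longrightarrow> finite (pairings S)"
  by (rule finite_subset[of _ "Pow (Pow S)"]) (auto simp: pairings_def partition_on_def)

lemma pairings_nonempty:
  assumes "finite S" and "even (card S)"
  shows "pairings S \<noteq> {}"
  using assms
proof (induction "card S" arbitrary: S rule: less_induct)
  case less
  show ?case
  proof (cases "S = {}")
    case True
    then show ?thesis by (auto simp: pairings_def partition_on_empty)
  next
    case False
    with less.prems have "card S \<noteq> 0" by simp
    with less.prems(2) have "2 \<le> card S" by presburger
    then obtain e where e: "e \<subseteq> S" "card e = 2"
      by (meson obtain_subset_with_card_n)
    have ne: "e \<noteq> {}" "finite e" using e less.prems finite_subset by auto
    have card: "card (S - e) = card S - 2" using e ne by (simp add: card_Diff_subset)
    then have "pairings (S - e) \<noteq> {}"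
      using less.prems \<open>2 \<le> card S\<close> by (intro less.hyps) auto
    then obtain P where P: "P \<in> pairings (S - e)" by blast
    then have "disjnt e (\<Union> P)" by (auto simp: pairings_def partition_on_def disjnt_def)
    then have "insert e P \<in> pairings S"
      using P e ne by (auto simp: pairings_def partition_on_insert)
    then show ?thesis by blast
  qed
qed

lemma even_total_degree_fix_parity: "even (total_degree n (fix_parity n d))"
proof (cases n)
  case 0
  then show ?thesis by (simp add: total_degree_def)
next
  case (Suc m)
  have "(\<Sum>i=1..m. fix_parity n d i) = (\<Sum>i=1..m. d i)"
    by (rule sum.cong) (auto simp: fix_parity_def Suc)
  then show ?thesis by (auto simp: total_degree_def fix_parity_def Suc)
qed

lemma pairings_stubs_nonempty:
  assumes "d \<in> set_pmf (iid_degrees D n)"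
  shows "pairings (stubs n d) \<noteq> {}"
proof -
  have "card (stubs n d) = total_degree n d"
    by (simp add: stubs_def total_degree_def)
  then have "even (card (stubs n d))"
    using assms by (auto simp: iid_degrees_def even_total_degree_fix_parity)
  then show ?thesis by (intro pairings_nonempty) (auto simp: stubs_def)
qed

definition edge_count :: "(nat \<times> nat) set set \<Rightarrow> nat \<Rightarrow> nat \<Rightarrow> nat" where
  "edge_count P i j = card {e \<in> P. \<exists>s t. e = {(i, s), (j, t)}}"

definition empirical_density :: "nat \<Rightarrow> (nat \<Rightarrow> nat) \<Rightarrow> nat \<Rightarrow> real" where
  "empirical_density n d k = (\<Sum>i=1..n. of_bool (d i = k)) / real n"


section \<open>The erased configuration model\<close>

definition erased_adj :: "(nat \<times> nat) set set \<Rightarrow> nat \<Rightarrow> nat \<Rightarrow> nat" where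
  "erased_adj P i j = of_bool (i \<noteq> j \<and> edge_count P i j \<ge> 1)"

definition erased_degree :: "nat \<Rightarrow> (nat \<times> nat) set set \<Rightarrow> nat \<Rightarrow> nat" where
  "erased_degree n P i = (\<Sum>j=1..n. erased_adj P i j)"

text \<open>The remaining statistics are those of a graph on \<open>{1..n}\<close> with adjacency matrix \<open>A\<close> and
  degrees \<open>d\<close>.\<close>

definition empirical_sb_density :: "nat \<Rightarrow> (nat \<Rightarrow> nat) \<Rightarrow> nat \<Rightarrow> real" where
  "empirical_sb_density n d k =
     (\<Sum>i=1..n. real k * of_bool (d i = k)) / real (total_degree n d)"

definition empirical_sb_cdf :: "nat \<Rightarrow> (nat \<Rightarrow> nat) \<Rightarrow> nat \<Rightarrow> real" where
  "empirical_sb_cdf n d l =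
     (\<Sum>i=1..n. real (d i) * of_bool (d i \<le> l)) / real (total_degree n d)"

definition empirical_joint_density ::
  "nat \<Rightarrow> (nat \<Rightarrow> nat \<Rightarrow> nat) \<Rightarrow> (nat \<Rightarrow> nat) \<Rightarrow> nat \<Rightarrow> nat \<Rightarrow> real" where
  "empirical_joint_density n A d k l =
     (\<Sum>i=1..n. \<Sum>j=1..n. real (A i j) * of_bool (d i = k \<and> d j = l)) / real (total_degree n d)"

text \<open>Average nearest neighbour rank; only finitely many terms of the infinite sum are nonzero.\<close>

definition annr ::
  "nat \<Rightarrow> (nat \<Rightarrow> nat \<Rightarrow> nat) \<Rightarrow> (nat \<Rightarrow> nat) \<Rightarrow> nat \<Rightarrow> real" where
  "annr n A d k =
     (if empirical_density n d k > 0
      then (\<Sum>\<^sub>\<infinity>l\<in>{0<..}. empirical_joint_density n A d k l * empirical_sb_cdf n d l)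
             / empirical_sb_density n d k
      else 0)"

definition erased_annr :: "nat \<Rightarrow> (nat \<times> nat) set set \<Rightarrow> nat \<Rightarrow> real" where
  "erased_annr n P k = annr n (erased_adj P) (erased_degree n P) k"

end

theory Submission
  imports Defs
begin

text \<open>Regular variation with \<open>\<gamma> > 1\<close> enters through the finite mean of \<open>D\<close>. All limits
  are taken in \<open>L\<^sup>1\<close>, with sums over stubs divided by the total degree \<open>L \<ge> n\<close>.

  In a uniform pairing two disjoint edges are nearly independent, so \<open>\<Sum> g(s) h(t)\<close> over matched stubs
  \<open>s, t\<close> has variance \<open>O(L)\<close>. For \<open>g\<close> the indicator of degree \<open>k\<close> and \<open>h = F*\<close> of the degree, the law of
  large numbers turns this into the limit \<open>f*(k) E[F*(D*)]\<close> for the numerator of the average nearest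
  neighbour rank without erasure. The same second moment bound shows that only \<open>O(M\<^sup>2)\<close> stubs between
  nodes of degree at most \<open>M\<close> are erased, and the proportion of stubs at larger degrees is about
  \<open>1 - F*(M)\<close>; so erasure changes a negligible proportion of stubs. Since \<open>F*\<close> is bounded and
  monotone, the rank is insensitive to this change.\<close>

text \<open>The obstacle is that only the mean of the degree is under control: its second moment may
  be infinite, and with it the naive bounds of order \<open>\<Sum> d\<^sup>2 / L\<close> for loops
  and of the square of this for multiple edges. Second moments are therefore taken only over the
  pairing, with the degrees fixed, or for truncated variables. Two truncation levels are required.
  Comparing the erased and the unerased distribution function, and bounding the stubs at changed
  nodes, costs a factor of order \<open>M\<close> in front of the erased proportion. That proportion
  is hence estimated with a level \<open>M'\<close> of its own, chosen after \<open>M\<close>;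
  \<open>n\<close> tends to infinity with both levels fixed. The erased total degree cancels between
  the numerator and the denominator of the rank, so both can be divided by the unerased
  \<open>L\<close>, which is fixed given the degrees. Since \<open>L \<ge> n\<close>, no exceptional
  event with few stubs has to be split off. The one denominator that has to be kept away from 0 is
  the share of stubs at erased degree \<open>k\<close>; its limit is the positive size-biased
  density at \<open>k\<close>.\<close>

section \<open>Second moments and conditional expectations\<close>

lemma (in prob_space) expectation_abs_le_sqrt:
  fixes X :: "'a \<Rightarrow> real"
  assumes "integrable M X" and "integrable M (\<lambda>x. (X x)\<^sup>2)" and "expectation (\<lambda>x. (X x)\<^sup>2) \<le> c"
  shows "expectation (\<lambda>x. \<bar>X x\<bar>) \<le> sqrt c"
proof -
  have "0 \<le> variance (\<lambda>x. \<bar>X x\<bar>)"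
    by (rule variance_positive)
  also have "\<dots> = expectation (\<lambda>x. (X x)\<^sup>2) - (expectation (\<lambda>x. \<bar>X x\<bar>))\<^sup>2"
    using assms by (subst variance_eq) auto
  finally show ?thesis
    using assms(3) by (intro real_le_rsqrt) linarith
qed

text \<open>The mean is taken over the pairing first and over the degrees second. The computation
  runs through nonnegative integrals, so integrability under the compound law is a result and not an
  assumption.\<close>

lemma expectation_bind_pmf_le:
  fixes f :: "'b \<Rightarrow> real" and b :: "'a \<Rightarrow> real"
  assumes "\<And>x. x \<in> set_pmf p \<Longrightarrow> integrable (measure_pmf (q x)) f"
    and "\<And>y. 0 \<le> f y"
    and "\<And>x. x \<in> set_pmf p \<Longrightarrow> measure_pmf.expectation (q x) f \<le> b x"
    and "integrable (measure_pmf p) b"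
  shows "integrable (measure_pmf (bind_pmf p q)) f"
    and "measure_pmf.expectation (bind_pmf p q) f \<le> measure_pmf.expectation p b"
proof -
  have b0: "0 \<le> b x" if "x \<in> set_pmf p" for x
    using assms(2) assms(3)[OF that] by (meson Bochner_Integration.integral_nonneg order_trans)
  have "(\<integral>\<^sup>+y. ennreal (f y) \<partial>measure_pmf (bind_pmf p q)) =
        (\<integral>\<^sup>+x. \<integral>\<^sup>+y. ennreal (f y) \<partial>q x \<partial>p)"
    by simp
  also have "\<dots> \<le> (\<integral>\<^sup>+x. ennreal (b x) \<partial>p)"
    using assms by (intro nn_integral_mono_AE AE_pmfI)
      (auto simp: nn_integral_eq_integral intro!: ennreal_leI)
  also have "\<dots> = ennreal (measure_pmf.expectation p b)"
    using assms(4) b0 by (intro nn_integral_eq_integral AE_pmfI) auto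
  finally have le: "(\<integral>\<^sup>+y. ennreal (f y) \<partial>measure_pmf (bind_pmf p q))
      \<le> ennreal (measure_pmf.expectation p b)" .
  show int: "integrable (measure_pmf (bind_pmf p q)) f"
    using le assms(2) by (intro integrableI_bounded) (auto simp: order_le_less_trans)
  have "0 \<le> measure_pmf.expectation p b"
    using b0 by (intro integral_nonneg_AE AE_pmfI)
  then show "measure_pmf.expectation (bind_pmf p q) f \<le> measure_pmf.expectation p b"
    using le by (subst (asm) nn_integral_eq_integral[OF int]) (simp_all add: assms(2))
qed

section \<open>Regularly varying distributions with finite mean\<close>

lemma integrable_measure_pmf_nat_iff:
  fixes f :: "nat \<Rightarrow> real"
  shows "integrable (measure_pmf p) f \<longleftrightarrow> summable (\<lambda>k. \<bar>pmf p k * f k\<bar>)"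
  unfolding measure_pmf_eq_density
  by (subst integrable_density) (auto simp: integrable_count_space_nat_iff)

text \<open>A one-sided Potter bound. A decreasing \<open>l\<close> is bounded from \<open>K\<close>
  on. For increasing \<open>l\<close> and \<open>m = k div 2\<close>, the argument satisfies
  \<open>2 * m \<le> k \<le> 3 * m\<close>, whence
  \<open>l k \<le> l (3 * m) \<le> 2 powr e * l m\<close>, and the factor is absorbed by
  \<open>(2 * m) powr e \<le> k powr e\<close>. The ratio at 3 instead of 2 takes care of odd
  \<open>k\<close>.\<close>

lemma slowly_varying_le_powr:
  assumes sv: "slowly_varying l" and em: "eventually_monotone l"
    and nn: "\<And>k::nat. 1 \<le> k \<Longrightarrow> 0 \<le> l (real k)" and e: "0 < e"
  obtains C K where "\<And>k. K \<le> k \<Longrightarrow> l (real k) \<le> C * real k powr e"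
proof -
  obtain x0 where x0: "mono_on {x0..} l \<or> antimono_on {x0..} l"
    using em by (auto simp: eventually_monotone_def)
  have lim: "((\<lambda>x. l (3 * x) / l x) \<longlongrightarrow> 1) at_top"
    using sv by (auto simp: slowly_varying_def)
  have "1 < 2 powr e" using e by simp
  \<comment> \<open>Positivity of the quotient excludes \<open>l x = 0\<close>, where division
    returns 0 and says nothing about \<open>l (3 * x)\<close>.\<close>
  then have "eventually (\<lambda>x. l (3 * x) / l x < 2 powr e \<and> 0 < l (3 * x) / l x) at_top"
    using order_tendstoD[OF lim] by (auto intro: eventually_conj)
  then obtain X where X: "\<And>x. X \<le> x \<Longrightarrow> l (3 * x) / l x < 2 powr e \<and> 0 < l (3 * x) / l x"
    by (auto simp: eventually_at_top_linorder)
  define K where "K = nat \<lceil>max (max X x0) 1\<rceil>"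
  have K: "X \<le> real k" "x0 \<le> real k" "1 \<le> k" if "K \<le> k" for k
    using that unfolding K_def by linarith+
  have tripl: "l (real (3 * m)) \<le> 2 powr e * l (real m)" if "K \<le> m" for m
    using X[of "real m"] K[OF that] nn[of m]
    by (cases "l (real m) = 0") (auto simp: divide_simps)
  from x0 show ?thesis
  proof
    assume anti: "antimono_on {x0..} l"
    have "l (real k) \<le> l (real K) * real k powr e" if "K \<le> k" for k
    proof -
      have "l (real k) \<le> l (real K)"
        using monotone_onD[OF anti, of "real K" "real k"] K[OF that] K[of K] that by auto
      also have "\<dots> \<le> l (real K) * real k powr e"
        using K[of K] K[OF that] nn[of K] e
        by (simp add: mult_le_cancel_left1 ge_one_powr_ge_zero)
      finally show ?thesis .
    qed
    then show ?thesis by (rule that)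
  next
    assume mono: "mono_on {x0..} l"
    \<comment> \<open>By monotonicity this bounds \<open>l\<close> between \<open>K\<close> and
      \<open>2 * K\<close>, where the recursion stops; beyond \<open>2 * K\<close>, halving stays
      above \<open>K\<close>.\<close>
    define C where "C = l (real (2 * K))"
    have C0: "0 \<le> C" unfolding C_def using K[of K] by (intro nn) auto
    have "l (real k) \<le> C * real k powr e" if "K \<le> k" for k
      using that
    proof (induction k rule: less_induct)
      case (less k)
      show ?case
      proof (cases "k \<le> 2 * K")
        case True
        have "l (real k) \<le> C"
          unfolding C_def using monotone_onD[OF mono, of "real k" "real (2 * K)"]
            K[OF less.prems] True by auto
        also have "\<dots> \<le> C * real k powr e"
          using C0 K[OF less.prems] e by (simp add: mult_le_cancel_left1 ge_one_powr_ge_zero)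
        finally show ?thesis .
      next
        case False
        define m where "m = k div 2"
        have m: "K \<le> m" "m < k" "k \<le> 3 * m" "2 * m \<le> k"
          using False K[of K] by (auto simp: m_def)
        have "l (real k) \<le> l (real (3 * m))"
          using monotone_onD[OF mono, of "real k" "real (3 * m)"] K[OF less.prems] m by auto
        also have "\<dots> \<le> 2 powr e * l (real m)" by (rule tripl[OF m(1)])
        also have "\<dots> \<le> 2 powr e * (C * real m powr e)"
          using less.IH[OF m(2) m(1)] by simp
        also have "\<dots> = C * real (2 * m) powr e" by (simp add: powr_mult)
        also have "\<dots> \<le> C * real k powr e"
          using C0 m(4) e by (intro mult_left_mono powr_mono2) auto
        finally show ?thesis .
      qed
    qed
    then show ?thesis by (rule that)
  qed
qed

lemma regularly_varying_integrable:
  assumes rv: "regularly_varying D \<gamma>" and \<gamma>: "1 < \<gamma>"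
  shows "integrable (measure_pmf D) real"
proof -
  obtain l where l: "slowly_varying l" "eventually_monotone l"
    "\<And>k. 1 \<le> k \<Longrightarrow> pmf D k = l (real k) * real k powr (- \<gamma> - 1)"
    using rv by (auto simp: regularly_varying_def)
  have nn: "0 \<le> l (real k)" if "1 \<le> k" for k
    using l(3)[OF that] pmf_nonneg[of D k] that by (auto simp: zero_le_mult_iff)
  \<comment> \<open>Half of the available room:
    \<open>e - \<gamma> = - (\<gamma> + 1) / 2 < -1\<close>, so the powers are summable.\<close>
  define e where "e = (\<gamma> - 1) / 2"
  have e: "0 < e" using \<gamma> by (simp add: e_def)
  obtain C K where CK: "\<And>k. K \<le> k \<Longrightarrow> l (real k) \<le> C * real k powr e"
    using slowly_varying_le_powr[OF l(1,2) nn e] by metis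
  have "summable (\<lambda>k. C * real k powr (e - \<gamma>))"
    using \<gamma> by (intro summable_mult) (simp add: summable_real_powr_iff e_def field_simps)
  then have "summable (\<lambda>k. \<bar>pmf D k * real k\<bar>)"
  proof (rule summable_comparison_test_ev[rotated])
    show "\<forall>\<^sub>F k in sequentially. norm \<bar>pmf D k * real k\<bar> \<le> C * real k powr (e - \<gamma>)"
      using eventually_ge_at_top[of "max 1 K"]
    proof eventually_elim
      case (elim k)
      have "pmf D k * real k = l (real k) * real k powr (- \<gamma>)"
        using elim by (simp add: l(3) powr_diff)
      also have "\<dots> \<le> (C * real k powr e) * real k powr (- \<gamma>)"
        using CK[of k] elim by (intro mult_right_mono) auto
      also have "\<dots> = C * real k powr (e - \<gamma>)"
        by (simp add: powr_diff powr_minus divide_inverse)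
      finally show ?case by simp
    qed
  qed
  then show ?thesis by (simp add: integrable_measure_pmf_nat_iff)
qed

section \<open>Uniform pairings\<close>

lemma pairing_edge:
  assumes "P \<in> pairings S" and "{a, b} \<in> P"
  shows "a \<in> S" and "b \<in> S" and "a \<noteq> b"
  using assms by (force simp: pairings_def partition_on_def card_insert_if)+

lemma pairing_edges_disjoint:
  assumes "P \<in> pairings S" and "e \<in> P" and "e' \<in> P" and "a \<in> e" and "a \<in> e'"
  shows "e = e'"
  using assms by (auto simp: pairings_def partition_on_def disjoint_def)

lemma pairing_unique:
  assumes "P \<in> pairings S" and "{a, b} \<in> P" and "{a, c} \<in> P"
  shows "b = c"
  using pairing_edges_disjoint[OF assms, of a] by (auto simp: doubleton_eq_iff)

lemma pairing_partner:
  assumes "P \<in> pairings S" and "a \<in> S"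
  obtains b where "b \<in> S - {a}" and "{a, b} \<in> P"
proof -
  obtain e where e: "e \<in> P" "a \<in> e" "card e = 2"
    using assms by (auto simp: pairings_def partition_on_def)
  then obtain b where "e = {a, b}" "b \<noteq> a"
    by (auto simp: card_2_iff)
  then show ?thesis using that pairing_edge[OF assms(1)] e by blast
qed

text \<open>Stated over any semiring because it serves real edge sums as well as natural-number edge
  counts.\<close>

lemma pairing_sum_partner:
  assumes P: "P \<in> pairings S" and "finite S" and "a \<in> S"
  shows "(\<Sum>b\<in>S. of_bool ({a, b} \<in> P)) = (1::'b::semiring_1)"
proof -
  obtain b where b: "b \<in> S - {a}" "{a, b} \<in> P"
    using pairing_partner[OF P assms(3)] .
  have "(\<Sum>c\<in>S. of_bool ({a, c} \<in> P)) = (\<Sum>c\<in>S. if c = b then 1 else (0::'b))"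
  proof (intro sum.cong refl)
    fix c
    have "{a, c} \<in> P \<longleftrightarrow> c = b" using pairing_unique[OF P b(2), of c] b by blast
    then show "of_bool ({a, c} \<in> P) = (if c = b then 1 else (0::'b))" by simp
  qed
  then show ?thesis using b assms by simp
qed

section \<open>Counting pairings that contain prescribed edges\<close>

text \<open>The self-similarity of uniform pairings: given that \<open>{a, b}\<close> is an edge,
  the rest is a uniform pairing of the other stubs. The edge probabilities below all come from
  this.\<close>

lemma bij_betw_insert_edge:
  assumes ab: "a \<in> S" "b \<in> S" "a \<noteq> b"
  shows "bij_betw (insert {a, b}) (pairings (S - {a, b})) {P \<in> pairings S. {a, b} \<in> P}"
proof (intro bij_betw_byWitness[where f' = "\<lambda>P. P - {{a, b}}"] subsetI ballI)
  have "{a, b} \<notin> P" if "P \<in> pairings (S - {a, b})" for P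
    using pairing_edge[OF that] by blast
  then show "insert {a, b} P - {{a, b}} = P" if "P \<in> pairings (S - {a, b})" for P
    using that by blast
  show "insert {a, b} (P - {{a, b}}) = P" if "P \<in> {P \<in> pairings S. {a, b} \<in> P}" for P
    using that by blast
  show "P \<in> {P \<in> pairings S. {a, b} \<in> P}" if P: "P \<in> insert {a, b} ` pairings (S - {a, b})" for P
  proof -
    obtain Q where Q: "Q \<in> pairings (S - {a, b})" "P = insert {a, b} Q"
      using P by blast
    then have "disjnt {a, b} (\<Union>Q)"
      by (auto simp: pairings_def partition_on_def)
    then show ?thesis
      using Q ab by (auto simp: pairings_def partition_on_insert)
  qed
  show "P \<in> pairings (S - {a, b})"
    if P: "P \<in> (\<lambda>P. P - {{a, b}}) ` {P \<in> pairings S. {a, b} \<in> P}" for P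
  proof -
    obtain Q where Q: "Q \<in> pairings S" "{a, b} \<in> Q" "P = Q - {{a, b}}"
      using P by blast
    then have ins: "Q = insert {a, b} P" by blast
    have "disjnt {a, b} (\<Union>P)"
      using pairing_edges_disjoint[OF Q(1) _ Q(2)] Q(3) by (auto simp: disjnt_def)
    then show ?thesis
      using Q(1) unfolding ins by (auto simp: pairings_def partition_on_insert)
  qed
qed

lemma card_pairings_edge:
  assumes "a \<in> S" "b \<in> S" "a \<noteq> b"
  shows "card {P \<in> pairings S. {a, b} \<in> P} = card (pairings (S - {a, b}))"
  using bij_betw_same_card[OF bij_betw_insert_edge[OF assms]] by simp

lemma card_pairings_two_edges:
  assumes "a \<in> S" "b \<in> S" "a \<noteq> b" "{c, d} \<noteq> {a, b}"
  shows "card {P \<in> pairings S. {a, b} \<in> P \<and> {c, d} \<in> P}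
    = card {P \<in> pairings (S - {a, b}). {c, d} \<in> P}"
proof -
  have image_restrict: "f ` {x \<in> A. Q (f x)} = {y \<in> f ` A. Q y}"
    for f :: "'a set set \<Rightarrow> 'a set set" and A Q
    by blast
  have "bij_betw (insert {a, b}) {P \<in> pairings (S - {a, b}). {c, d} \<in> P}
      (insert {a, b} ` {P \<in> pairings (S - {a, b}). {c, d} \<in> P})"
    by (rule bij_betw_subset[OF bij_betw_insert_edge[OF assms(1-3)] _ refl]) (rule Collect_restrict)
  moreover have "insert {a, b} ` {P \<in> pairings (S - {a, b}). {c, d} \<in> P}
      = {P \<in> pairings S. {a, b} \<in> P \<and> {c, d} \<in> P}"
  proof -
    have iff: "{c, d} \<in> insert {a, b} P \<longleftrightarrow> {c, d} \<in> P" for P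
      using assms(4) by simp
    have "insert {a, b} ` {P \<in> pairings (S - {a, b}). {c, d} \<in> P}
        = {Q \<in> insert {a, b} ` pairings (S - {a, b}). {c, d} \<in> Q}"
      using image_restrict[of "insert {a, b}" "pairings (S - {a, b})" "\<lambda>Q. {c, d} \<in> Q"]
      unfolding iff .
    also have "\<dots> = {P \<in> pairings S. {a, b} \<in> P \<and> {c, d} \<in> P}"
      unfolding bij_betw_imp_surj_on[OF bij_betw_insert_edge[OF assms(1-3)]] by simp
    finally show ?thesis .
  qed
  ultimately show ?thesis by (simp only: bij_betw_same_card)
qed

lemma card_pairings_rec:
  assumes "finite S" and "a \<in> S"
  shows "card (pairings S) = (\<Sum>b\<in>S - {a}. card (pairings (S - {a, b})))"
proof -
  have "pairings S = (\<Union>b\<in>S - {a}. {P \<in> pairings S. {a, b} \<in> P})"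
    using pairing_partner[OF _ assms(2)] by blast
  also have "card \<dots> = (\<Sum>b\<in>S - {a}. card {P \<in> pairings S. {a, b} \<in> P})"
  proof (intro card_UN_disjoint ballI impI)
    show "{P \<in> pairings S. {a, b} \<in> P} \<inter> {P \<in> pairings S. {a, c} \<in> P} = {}"
      if "b \<noteq> c" for b c
      using pairing_unique[of _ S a b c] that by blast
  qed (simp_all add: assms finite_pairings[OF assms(1)])
  also have "\<dots> = (\<Sum>b\<in>S - {a}. card (pairings (S - {a, b})))"
    using assms(2) by (intro sum.cong refl card_pairings_edge) auto
  finally show ?thesis .
qed

text \<open>The double factorial \<open>(m - 1)!!\<close> for even \<open>m\<close>, and 0 for odd
  \<open>m\<close>.\<close>

fun num_pairings :: "nat \<Rightarrow> nat" where
  "num_pairings 0 = 1"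
| "num_pairings (Suc 0) = 0"
| "num_pairings (Suc (Suc m)) = Suc m * num_pairings m"

lemma card_pairings: "finite S \<Longrightarrow> card (pairings S) = num_pairings (card S)"
proof (induction "card S" arbitrary: S rule: num_pairings.induct)
  case 1
  then have "pairings S = {{}}" by (auto simp: pairings_def partition_on_empty)
  with 1 show ?case by simp
next
  case 2
  then obtain a where "S = {a}" by (metis card_1_singletonE One_nat_def)
  then show ?case using card_pairings_rec[of S a] by simp
next
  case (3 m)
  then obtain a where a: "a \<in> S" by fastforce
  have "card (pairings (S - {a, b})) = num_pairings m" if "b \<in> S - {a}" for b
  proof -
    have "card (S - {a, b}) = m"
      using 3(3) a that by (auto simp: card_Diff_subset 3(2)[symmetric])
    with 3(1)[of "S - {a, b}"] 3(3) show ?thesis by simp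
  qed
  then have "card (pairings S) = card (S - {a}) * num_pairings m"
    using card_pairings_rec[OF 3(3) a] by simp
  also have "card (S - {a}) = Suc m" using 3(2,3) a by simp
  finally show ?case by (simp add: 3(2)[symmetric])
qed

lemma card_pairings_pos:
  "finite S \<Longrightarrow> even (card S) \<Longrightarrow> 0 < card (pairings S)"
  using pairings_nonempty finite_pairings by (metis card_gt_0_iff)

text \<open>The quotient is the probability that a uniform pairing contains \<open>{a, b}\<close>:
  each of the other \<open>card S - 1\<close> stubs is equally likely to be the partner of
  \<open>a\<close>. Even cardinality makes the denominator positive.\<close>

lemma card_pairings_Diff:
  assumes "finite S" "even (card S)" "a \<in> S" "b \<in> S" "a \<noteq> b"
  shows "real (card (pairings (S - {a, b}))) / card (pairings S) = 1 / (real (card S) - 1)"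
proof -
  have "{a, b} \<subseteq> S" "card {a, b} = 2" using assms by auto
  then have "2 \<le> card S" using assms(1) card_mono by metis
  then obtain m where m: "card S = Suc (Suc m)"
    by (metis add_2_eq_Suc le_Suc_ex)
  have "card (S - {a, b}) = m" using assms m by (simp add: card_Diff_subset)
  then have "card (pairings (S - {a, b})) = num_pairings m"
    using card_pairings[of "S - {a, b}"] assms(1) by simp
  moreover have "card (pairings S) = Suc m * num_pairings m"
    by (simp only: card_pairings[OF assms(1)] m num_pairings.simps)
  moreover have "0 < num_pairings m"
    using card_pairings_pos[OF assms(1,2)] calculation by (metis mult_is_0 neq0_conv)
  ultimately show ?thesis
    using m by (simp only: of_nat_mult) simp
qed

section \<open>First and second moments of edge sums\<close>

lemma expectation_pairings:
  fixes f :: "'a set set \<Rightarrow> real"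
  assumes "finite S" "even (card S)"
  shows "measure_pmf.expectation (pmf_of_set (pairings S)) f
    = (\<Sum>P\<in>pairings S. f P) / card (pairings S)"
  using assms by (simp add: integral_pmf_of_set finite_pairings pairings_nonempty)

lemma integrable_pairings:
  fixes f :: "'a set set \<Rightarrow> real"
  assumes "finite S" "even (card S)"
  shows "integrable (measure_pmf (pmf_of_set (pairings S))) f"
  using assms by (intro integrable_measure_pmf_finite) (simp add: finite_pairings pairings_nonempty)

lemma expectation_edge:
  assumes "finite S" "even (card S)" "a \<in> S" "b \<in> S" "a \<noteq> b"
  shows "measure_pmf.expectation (pmf_of_set (pairings S)) (\<lambda>P. of_bool ({a, b} \<in> P) :: real)
    = 1 / (real (card S) - 1)"
proof -
  have "(\<Sum>P\<in>pairings S. of_bool ({a, b} \<in> P)) = real (card {P \<in> pairings S. {a, b} \<in> P})"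
    using finite_pairings[OF assms(1)] by (simp add: sum_of_bool_eq Int_def)
  then show ?thesis
    unfolding expectation_pairings[OF assms(1,2)] card_pairings_edge[OF assms(3-5)]
    using card_pairings_Diff[OF assms] by simp
qed

text \<open>Removing one edge leaves a uniform pairing of two stubs fewer, so the two edge
  probabilities multiply with \<open>card S - 3\<close> in the second factor. The deviation from
  independence is a relative error of order \<open>1 / card S\<close>.\<close>

lemma expectation_two_edges:
  assumes "finite S" "even (card S)" "a \<in> S" "b \<in> S" "a \<noteq> b" "c \<in> S" "d \<in> S" "c \<noteq> d"
    and "{a, b} \<inter> {c, d} = {}"
  shows "measure_pmf.expectation (pmf_of_set (pairings S))
      (\<lambda>P. of_bool ({a, b} \<in> P) * of_bool ({c, d} \<in> P) :: real)
    = 1 / ((real (card S) - 1) * (real (card S) - 3))"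
proof -
  let ?S = "S - {a, b}" and ?N = "\<lambda>S. real (card (pairings S))"
  have ratio: "z / x = (y / x) * (z / y)" if "y \<noteq> 0" for x y z :: real
    using that by simp
  have cS: "card ?S = card S - 2" "2 \<le> card S"
    using assms(1,3,4,5) card_mono[of S "{a, b}"] by (auto simp: card_Diff_subset)
  have S': "finite ?S" "even (card ?S)" "c \<in> ?S" "d \<in> ?S"
  proof -
    show "finite ?S" using assms(1) by simp
    show "even (card ?S)" unfolding cS(1) using assms(2) by simp
    show "c \<in> ?S" "d \<in> ?S" using assms(6,7,9) by blast+
  qed
  have "measure_pmf.expectation (pmf_of_set (pairings S))
      (\<lambda>P. of_bool ({a, b} \<in> P) * of_bool ({c, d} \<in> P) :: real)
    = card {P \<in> pairings S. {a, b} \<in> P \<and> {c, d} \<in> P} / ?N S"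
  proof -
    have "(\<Sum>P\<in>pairings S. of_bool ({a, b} \<in> P \<and> {c, d} \<in> P))
        = real (card {P \<in> pairings S. {a, b} \<in> P \<and> {c, d} \<in> P})"
      using finite_pairings[OF assms(1)] by (subst sum_of_bool_eq) (simp_all add: Int_def)
    then show ?thesis
      unfolding expectation_pairings[OF assms(1,2)] of_bool_conj by (simp only:)
  qed
  also have "\<dots> = ?N (?S - {c, d}) / ?N S"
  proof -
    have "{c, d} \<noteq> {a, b}" using assms(9) by auto
    then show ?thesis
      using card_pairings_two_edges[OF assms(3-5), of c d] card_pairings_edge[OF S'(3,4) assms(8)]
      by (simp only: not_False_eq_True simp_thms)
  qed
  also have "\<dots> = (?N ?S / ?N S) * (?N (?S - {c, d}) / ?N ?S)"
    using ratio[of "?N ?S" "?N (?S - {c, d})" "?N S"] card_pairings_pos[OF S'(1,2)] by linarith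
  also have "\<dots> = 1 / ((real (card S) - 1) * (real (card S) - 3))"
    unfolding card_pairings_Diff[OF assms(1-5)] card_pairings_Diff[OF S' assms(8)] cS(1)
      of_nat_diff[OF cS(2)]
    by (simp only: of_nat_numeral diff_diff_eq numeral_plus_one arith_simps times_divide_times_eq mult_1)
  finally show ?thesis .
qed

text \<open>Ordered pairs see each edge twice, once per orientation, so the total is the number of
  stubs and not of edges.\<close>

lemma pairing_sum_edges:
  assumes "P \<in> pairings S" and "finite S"
  shows "(\<Sum>x\<in>S \<times> S. of_bool ({fst x, snd x} \<in> P)) = real (card S)"
proof -
  have "(\<Sum>x\<in>S \<times> S. of_bool ({fst x, snd x} \<in> P)) = (\<Sum>a\<in>S. \<Sum>b\<in>S. of_bool ({a, b} \<in> P) :: real)"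
    by (simp add: sum.cartesian_product case_prod_beta)
  also have "\<dots> = (\<Sum>a\<in>S. 1)"
    using assms by (intro sum.cong refl pairing_sum_partner)
  finally show ?thesis by simp
qed

lemma expectation_sum_edges:
  assumes "finite S" "even (card S)"
  shows "measure_pmf.expectation (pmf_of_set (pairings S))
      (\<lambda>P. \<Sum>x\<in>S \<times> S. W x * of_bool ({fst x, snd x} \<in> P))
    = (\<Sum>x\<in>S \<times> S. W x * of_bool (fst x \<noteq> snd x)) / (real (card S) - 1)"
proof -
  have int: "integrable (measure_pmf (pmf_of_set (pairings S))) f" for f :: "_ \<Rightarrow> real"
    using assms by (rule integrable_pairings)
  have edge: "measure_pmf.expectation (pmf_of_set (pairings S)) (\<lambda>P. of_bool ({fst x, snd x} \<in> P))
      = of_bool (fst x \<noteq> snd x) / (real (card S) - 1)" if "x \<in> S \<times> S" for x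
  proof (cases "fst x = snd x")
    case True
    then have "{fst x, snd x} \<notin> P" if "P \<in> pairings S" for P
      using pairing_edge(3)[OF that] by blast
    then show ?thesis
      using True assms by (simp add: expectation_pairings del: insert_absorb2)
  next
    case False
    then show ?thesis using expectation_edge[OF assms, of "fst x" "snd x"] that by auto
  qed
  show ?thesis
    using edge by (simp add: int sum_divide_distrib cong: sum.cong)
qed

text \<open>Two edges of a pairing are equal or disjoint. Equal edges come from \<open>y = x\<close>
  or \<open>y = prod.swap x\<close> and give the single sum; disjoint ones give the double sum, to
  which the two-edge probability applies.\<close>

lemma edge_sum_square_le:
  fixes W :: "'a \<times> 'a \<Rightarrow> real"
  assumes P: "P \<in> pairings S" and S: "finite S" and W: "\<And>x. 0 \<le> W x"
  defines "E \<equiv> \<lambda>x. {fst x, snd x}"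
  shows "(\<Sum>x\<in>S \<times> S. W x * of_bool (E x \<in> P))\<^sup>2
    \<le> (\<Sum>x\<in>S \<times> S. (W x * W x + W x * W (prod.swap x)) * of_bool (E x \<in> P))
      + (\<Sum>x\<in>S \<times> S. \<Sum>y\<in>S \<times> S. of_bool (E x \<inter> E y = {}) * (W x * W y)
          * (of_bool (E x \<in> P) * of_bool (E y \<in> P)))"
proof -
  let ?e = "\<lambda>x. of_bool (E x \<in> P) :: real"
  have pt: "W x * ?e x * (W y * ?e y)
      \<le> (if y = x then W x * W y * ?e x else 0) + (if y = prod.swap x then W x * W y * ?e x else 0)
        + of_bool (E x \<inter> E y = {}) * (W x * W y) * (?e x * ?e y)" for x y
  proof (cases "E x \<in> P \<and> E y \<in> P \<and> E x \<inter> E y \<noteq> {}")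
    case True
    then have "E x = E y"
      using pairing_edges_disjoint[OF P, of "E x" "E y"] by blast
    then have "y = x \<or> y = prod.swap x"
      by (auto simp: E_def doubleton_eq_iff prod_eq_iff)
    then show ?thesis
      using W[of x] W[of y] by (auto simp: mult_ac)
  next
    case False
    then show ?thesis using W[of x] W[of y] by auto
  qed
  have "(\<Sum>x\<in>S \<times> S. W x * ?e x)\<^sup>2 = (\<Sum>x\<in>S \<times> S. \<Sum>y\<in>S \<times> S. W x * ?e x * (W y * ?e y))"
    by (simp add: power2_eq_square sum_product)
  also have "\<dots> \<le> (\<Sum>x\<in>S \<times> S. \<Sum>y\<in>S \<times> S.
        (if y = x then W x * W y * ?e x else 0) + (if y = prod.swap x then W x * W y * ?e x else 0)
        + of_bool (E x \<inter> E y = {}) * (W x * W y) * (?e x * ?e y))"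
    by (intro sum_mono pt)
  also have "\<dots> = (\<Sum>x\<in>S \<times> S. (W x * W x + W x * W (prod.swap x)) * ?e x)
      + (\<Sum>x\<in>S \<times> S. \<Sum>y\<in>S \<times> S. of_bool (E x \<inter> E y = {}) * (W x * W y) * (?e x * ?e y))"
  proof -
    have sw: "prod.swap x \<in> S \<times> S" if "x \<in> S \<times> S" for x using that by auto
    show ?thesis
      using S by (simp add: sum.distrib sum.delta sw distrib_right cong: sum.cong)
  qed
  finally show ?thesis .
qed

text \<open>As the weights are nonnegative, the double sum may be completed to all pairs, which
  yields the square of the total weight. The single sum stays an expectation because its two
  applications evaluate it differently: once by the number of stubs, once as the mean of an edge
  count.\<close>

lemma expectation_edge_sum_square_le:
  fixes W :: "'a \<times> 'a \<Rightarrow> real"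
  assumes S: "finite S" "even (card S)" "4 \<le> card S" and W: "\<And>x. 0 \<le> W x"
  defines "E \<equiv> \<lambda>x. {fst x, snd x}"
  shows "measure_pmf.expectation (pmf_of_set (pairings S))
      (\<lambda>P. (\<Sum>x\<in>S \<times> S. W x * of_bool (E x \<in> P))\<^sup>2)
    \<le> measure_pmf.expectation (pmf_of_set (pairings S))
        (\<lambda>P. \<Sum>x\<in>S \<times> S. (W x * W x + W x * W (prod.swap x)) * of_bool (E x \<in> P))
      + (\<Sum>x\<in>S \<times> S. W x)\<^sup>2 / ((real (card S) - 1) * (real (card S) - 3))"
    (is "?lhs \<le> ?A + _")
proof -
  let ?M = "measure_pmf (pmf_of_set (pairings S))"
  let ?e = "\<lambda>x P. of_bool (E x \<in> P) :: real"
  let ?q = "(real (card S) - 1) * (real (card S) - 3)"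
  have int: "integrable ?M f" for f :: "_ \<Rightarrow> real"
    using S(1,2) by (rule integrable_pairings)
  have q: "0 \<le> 1 / ?q" using S(3) by simp
  have two: "of_bool (E x \<inter> E y = {}) * (W x * W y) * integral\<^sup>L ?M (\<lambda>P. ?e x P * ?e y P)
      \<le> W x * W y * (1 / ?q)" if "x \<in> S \<times> S" "y \<in> S \<times> S" for x y
  proof (cases "E x \<inter> E y = {}")
    case True
    have "integral\<^sup>L ?M (\<lambda>P. ?e x P * ?e y P) \<le> 1 / ?q"
    proof (cases "fst x \<noteq> snd x \<and> fst y \<noteq> snd y")
      case ne: True
      show ?thesis
        using expectation_two_edges[OF S(1,2), of "fst x" "snd x" "fst y" "snd y"] ne that True
        unfolding E_def by (auto simp: mem_Times_iff)
    next
      case False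
      then have "?e x P * ?e y P = 0" if "P \<in> pairings S" for P
        using pairing_edge(3)[OF that, of "fst x" "snd x"] pairing_edge(3)[OF that, of "fst y" "snd y"]
        by (auto simp: E_def)
      then have "integral\<^sup>L ?M (\<lambda>P. ?e x P * ?e y P) = 0"
        by (subst expectation_pairings[OF S(1,2)]) (simp only: div_0 sum.neutral_const cong: sum.cong)
      then show ?thesis using q by simp
    qed
    then show ?thesis
      using True W[of x] W[of y] by (simp only: of_bool_eq mult_1 simp_thms)
        (intro mult_left_mono mult_nonneg_nonneg)
  next
    case False
    then show ?thesis using W[of x] W[of y] q by simp
  qed
  have "?lhs \<le> integral\<^sup>L ?M (\<lambda>P. (\<Sum>x\<in>S \<times> S. (W x * W x + W x * W (prod.swap x)) * ?e x P)
      + (\<Sum>x\<in>S \<times> S. \<Sum>y\<in>S \<times> S. of_bool (E x \<inter> E y = {}) * (W x * W y) * (?e x P * ?e y P)))"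
  proof (rule integral_mono_AE[OF int int], rule AE_pmfI)
    fix P assume "P \<in> set_pmf (pmf_of_set (pairings S))"
    then have "P \<in> pairings S"
      using S(1,2) by (simp add: finite_pairings pairings_nonempty)
    from edge_sum_square_le[OF this S(1) W]
    show "(\<Sum>x\<in>S \<times> S. W x * ?e x P)\<^sup>2
      \<le> (\<Sum>x\<in>S \<times> S. (W x * W x + W x * W (prod.swap x)) * ?e x P)
      + (\<Sum>x\<in>S \<times> S. \<Sum>y\<in>S \<times> S. of_bool (E x \<inter> E y = {}) * (W x * W y) * (?e x P * ?e y P))"
      unfolding E_def .
  qed
  also have "\<dots> = ?A + (\<Sum>x\<in>S \<times> S. \<Sum>y\<in>S \<times> S.
      of_bool (E x \<inter> E y = {}) * (W x * W y) * integral\<^sup>L ?M (\<lambda>P. ?e x P * ?e y P))"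
    by (subst Bochner_Integration.integral_add[OF int int])
       (simp add: Bochner_Integration.integral_sum int)
  also have "\<dots> \<le> ?A + (\<Sum>x\<in>S \<times> S. \<Sum>y\<in>S \<times> S. W x * W y * (1 / ?q))"
    using two by (intro add_left_mono sum_mono) blast
  also have "(\<Sum>x\<in>S \<times> S. \<Sum>y\<in>S \<times> S. W x * W y * (1 / ?q)) = (\<Sum>x\<in>S \<times> S. W x)\<^sup>2 / ?q"
    by (simp add: power2_eq_square sum_product sum_divide_distrib)
  finally show ?thesis .
qed


lemma expectation_edge_average:
  fixes g h :: "'a \<Rightarrow> real"
  assumes S: "finite S" "even (card S)" "4 \<le> card S"
    and g: "\<And>s. 0 \<le> g s" "\<And>s. g s \<le> 1" and h: "\<And>s. 0 \<le> h s" "\<And>s. h s \<le> 1"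
  defines "L \<equiv> real (card S)"
  shows "measure_pmf.expectation (pmf_of_set (pairings S))
      (\<lambda>P. \<bar>(\<Sum>x\<in>S \<times> S. g (fst x) * h (snd x) * of_bool ({fst x, snd x} \<in> P)) / L
        - (\<Sum>s\<in>S. g s) / L * ((\<Sum>s\<in>S. h s) / L)\<bar>) \<le> sqrt (20 / L)"
proof -
  let ?M = "measure_pmf (pmf_of_set (pairings S))"
  let ?W = "\<lambda>x. g (fst x) * h (snd x)"
  define X where "X = (\<lambda>P. \<Sum>x\<in>S \<times> S. ?W x * of_bool ({fst x, snd x} \<in> P))"
  define q where "q = (\<Sum>s\<in>S. g s) * (\<Sum>s\<in>S. h s)"
  have int: "integrable ?M f" for f :: "_ \<Rightarrow> real"
    using S(1,2) by (rule integrable_pairings)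
  have L: "4 \<le> L" using S(3) by (simp add: L_def)
  have W: "0 \<le> ?W x" "?W x \<le> 1" for x
    using g h by (auto intro: mult_le_one)
  have sumW: "(\<Sum>x\<in>S \<times> S. ?W x) = q"
    by (simp add: q_def sum_product sum.cartesian_product case_prod_beta)
  have "(\<Sum>s\<in>S. g s) \<le> L" "(\<Sum>s\<in>S. h s) \<le> L"
    using sum_mono[of S g "\<lambda>_. 1"] sum_mono[of S h "\<lambda>_. 1"] g h by (simp_all add: L_def)
  then have q: "0 \<le> q" "q \<le> L\<^sup>2"
    using g h L by (auto simp: q_def power2_eq_square intro!: mult_mono mult_nonneg_nonneg sum_nonneg)
  \<comment> \<open>A stub is never matched to itself. Dropping these pairs from \<open>q\<close>
    costs at most \<open>L\<close>, which is of order \<open>1 / L\<close> after division by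
    \<open>L\<^sup>2\<close>.\<close>
  have diag: "(\<Sum>x\<in>S \<times> S. ?W x * of_bool (fst x = snd x)) \<le> L"
  proof -
    have "(\<Sum>x\<in>S \<times> S. ?W x * of_bool (fst x = snd x)) = (\<Sum>a\<in>S. \<Sum>b\<in>S. if a = b then g a * h b else 0)"
      by (simp add: sum.cartesian_product case_prod_beta of_bool_def if_distrib cong: if_cong)
    also have "\<dots> = (\<Sum>a\<in>S. g a * h a)" using S(1) by simp
    also have "\<dots> \<le> (\<Sum>a\<in>S. 1)" using g h by (intro sum_mono mult_le_one) auto
    finally show ?thesis by (simp add: L_def)
  qed
  have EX: "(q - L) / (L - 1) \<le> integral\<^sup>L ?M X"
  proof -
    have "q = (\<Sum>x\<in>S \<times> S. ?W x * of_bool (fst x = snd x)) + (\<Sum>x\<in>S \<times> S. ?W x * of_bool (fst x \<noteq> snd x))"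
      unfolding sumW[symmetric] sum.distrib[symmetric] by (intro sum.cong) auto
    then have "q - L \<le> (\<Sum>x\<in>S \<times> S. ?W x * of_bool (fst x \<noteq> snd x))"
      using diag by linarith
    then show ?thesis
      unfolding X_def expectation_sum_edges[OF S(1,2)] L_def[symmetric]
      using L by (intro divide_right_mono) auto
  qed
  have "integral\<^sup>L ?M (\<lambda>P. \<Sum>x\<in>S \<times> S. (?W x * ?W x + ?W x * ?W (prod.swap x)) * of_bool ({fst x, snd x} \<in> P))
      \<le> integral\<^sup>L ?M (\<lambda>P. 2 * L)"
  proof (rule integral_mono_AE[OF int int], rule AE_pmfI)
    fix P assume "P \<in> set_pmf (pmf_of_set (pairings S))"
    then have P: "P \<in> pairings S"
      using S(1,2) by (simp add: finite_pairings pairings_nonempty)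
    have WW: "?W x * ?W x + ?W x * ?W (prod.swap x) \<le> 2" for x
      using mult_le_one[OF W(2,1,2), of x x] mult_le_one[OF W(2,1,2), of x "prod.swap x"] by linarith
    have "(\<Sum>x\<in>S \<times> S. (?W x * ?W x + ?W x * ?W (prod.swap x)) * of_bool ({fst x, snd x} \<in> P))
        \<le> (\<Sum>x\<in>S \<times> S. 2 * of_bool ({fst x, snd x} \<in> P))"
      using WW by (intro sum_mono mult_right_mono) auto
    also have "\<dots> = 2 * L"
      unfolding sum_distrib_left[symmetric] pairing_sum_edges[OF P S(1)] L_def ..
    finally show "(\<Sum>x\<in>S \<times> S. (?W x * ?W x + ?W x * ?W (prod.swap x)) * of_bool ({fst x, snd x} \<in> P)) \<le> 2 * L" .
  qed
  then have EX2: "integral\<^sup>L ?M (\<lambda>P. (X P)\<^sup>2) \<le> 2 * L + q\<^sup>2 / ((L - 1) * (L - 3))"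
    using expectation_edge_sum_square_le[OF S, of ?W] W(1) unfolding X_def sumW L_def[symmetric] by simp
  \<comment> \<open>The deviation is measured from \<open>q / L\<^sup>2\<close> and not from the
    mean of \<open>X\<close>. The cross term is negative, so an upper bound on the second moment and
    a lower bound on the mean suffice.\<close>
  have "integral\<^sup>L ?M (\<lambda>P. (X P / L - q / L\<^sup>2)\<^sup>2)
      = integral\<^sup>L ?M (\<lambda>P. (X P)\<^sup>2 / L\<^sup>2 - 2 * q / L ^ 3 * X P + q\<^sup>2 / L ^ 4)"
    using L by (intro arg_cong[of _ _ "integral\<^sup>L ?M"] ext) (simp add: field_simps power2_eq_square eval_nat_numeral)
  also have "\<dots> = integral\<^sup>L ?M (\<lambda>P. (X P)\<^sup>2) / L\<^sup>2 - 2 * q / L ^ 3 * integral\<^sup>L ?M X + q\<^sup>2 / L ^ 4"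
    using int by simp
  also have "\<dots> \<le> (2 * L + q\<^sup>2 / ((L - 1) * (L - 3))) / L\<^sup>2 - 2 * q / L ^ 3 * ((q - L) / (L - 1)) + q\<^sup>2 / L ^ 4"
    using EX EX2 q L by (intro add_mono diff_mono divide_right_mono mult_left_mono) auto
  \<comment> \<open>Near independence shows here: over the common denominator the coefficient of
    \<open>q\<^sup>2\<close> has numerator
    \<open>L\<^sup>2 - 2 * L * (L - 3) + (L - 1) * (L - 3) = 2 * L + 3\<close>, the quadratic terms
    cancelling.\<close>
  also have "\<dots> = 2 / L + q\<^sup>2 * (2 * L + 3) / (L ^ 4 * ((L - 1) * (L - 3))) + 2 * q / (L\<^sup>2 * (L - 1))"
  proof -
    have "L \<noteq> 0" "L - 1 \<noteq> 0" "L - 3 \<noteq> 0" using L by auto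
    then show ?thesis by (simp add: divide_simps) (simp add: algebra_simps eval_nat_numeral)
  qed
  also have "\<dots> \<le> 2 / L + (L\<^sup>2)\<^sup>2 * (2 * L + 3) / (L ^ 4 * ((L - 1) * (L - 3))) + 2 * L\<^sup>2 / (L\<^sup>2 * (L - 1))"
    using q L by (intro add_mono divide_right_mono mult_right_mono power_mono) auto
  also have "\<dots> = 2 / L + (2 * L + 3) / ((L - 1) * (L - 3)) + 2 / (L - 1)"
    using L by simp
  \<comment> \<open>With \<open>L \<ge> 4\<close> the three terms give
    \<open>2 + 44 / 3 + 8 / 3 = 58 / 3\<close> times \<open>1 / L\<close>.\<close>
  also have "\<dots> \<le> 20 / L"
  proof -
    have A: "1 / (L - 1) \<le> 4 / 3 * (1 / L)" using L by (simp add: field_simps)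
    have B: "(2 * L + 3) / (L - 3) \<le> 11" using L by (simp add: field_simps)
    have "(2 * L + 3) / ((L - 1) * (L - 3)) = (2 * L + 3) / (L - 3) * (1 / (L - 1))" by simp
    also have "\<dots> \<le> 11 * (4 / 3 * (1 / L))" using A B L by (intro mult_mono) auto
    finally have "(2 * L + 3) / ((L - 1) * (L - 3)) \<le> 44 / 3 * (1 / L)" by simp
    moreover have "2 / L = 2 * (1 / L)" "2 / (L - 1) = 2 * (1 / (L - 1))" "20 / L = 20 * (1 / L)"
      "0 \<le> 1 / L" using L by auto
    ultimately show ?thesis using A by linarith
  qed
  finally have "integral\<^sup>L ?M (\<lambda>P. (X P / L - q / L\<^sup>2)\<^sup>2) \<le> 20 / L" .
  then have "integral\<^sup>L ?M (\<lambda>P. \<bar>X P / L - q / L\<^sup>2\<bar>) \<le> sqrt (20 / L)"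
    by (intro measure_pmf.expectation_abs_le_sqrt int)
  then show ?thesis
    by (simp add: X_def q_def power2_eq_square)
qed

section \<open>Erased stubs\<close>

text \<open>Ordered pairs of stubs are counted, so a self-loop counts twice and every row adds up to
  the degree; \<open>edge_count\<close> counts a loop once.\<close>

definition stub_adj :: "(nat \<Rightarrow> nat) \<Rightarrow> (nat \<times> nat) set set \<Rightarrow> nat \<Rightarrow> nat \<Rightarrow> nat" where
  "stub_adj d P i j = (\<Sum>a<d i. \<Sum>b<d j. of_bool ({(i, a), (j, b)} \<in> P))"

lemma finite_stubs [simp]: "finite (stubs n d)"
  by (simp add: stubs_def)

lemma card_stubs: "card (stubs n d) = total_degree n d"
  by (simp add: stubs_def total_degree_def)

lemma sum_stubs: "(\<Sum>s\<in>stubs n d. f s) = (\<Sum>i=1..n. \<Sum>a<d i. f (i, a))"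
  by (simp add: stubs_def sum.Sigma)

lemma sum_stub_pairs:
  fixes w :: "nat \<Rightarrow> nat \<Rightarrow> 'a::comm_semiring_1"
  shows "(\<Sum>x\<in>stubs n d \<times> stubs n d. w (fst (fst x)) (fst (snd x)) * of_bool ({fst x, snd x} \<in> P))
    = (\<Sum>i=1..n. \<Sum>j=1..n. w i j * of_nat (stub_adj d P i j))"
proof -
  have "(\<Sum>x\<in>stubs n d \<times> stubs n d. w (fst (fst x)) (fst (snd x)) * of_bool ({fst x, snd x} \<in> P))
    = (\<Sum>s\<in>stubs n d. \<Sum>t\<in>stubs n d. w (fst s) (fst t) * of_bool ({s, t} \<in> P))"
    unfolding sum.cartesian_product by (intro sum.cong refl) auto
  also have "\<dots> = (\<Sum>i=1..n. \<Sum>a<d i. \<Sum>j=1..n. \<Sum>b<d j. w i j * of_bool ({(i, a), (j, b)} \<in> P))"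
    by (simp add: sum_stubs)
  also have "\<dots> = (\<Sum>i=1..n. \<Sum>j=1..n. \<Sum>a<d i. \<Sum>b<d j. w i j * of_bool ({(i, a), (j, b)} \<in> P))"
    by (intro sum.cong refl sum.swap)
  also have "\<dots> = (\<Sum>i=1..n. \<Sum>j=1..n. w i j * of_nat (stub_adj d P i j))"
    unfolding stub_adj_def by (simp only: sum_distrib_left of_nat_sum of_nat_of_bool)
  finally show ?thesis .
qed

lemma sum_stub_adj:
  assumes "P \<in> pairings (stubs n d)" and "i \<in> {1..n}"
  shows "(\<Sum>j=1..n. stub_adj d P i j) = d i"
proof -
  have "(\<Sum>j=1..n. stub_adj d P i j) = (\<Sum>a<d i. \<Sum>j=1..n. \<Sum>b<d j. of_bool ({(i, a), (j, b)} \<in> P))"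
    unfolding stub_adj_def by (rule sum.swap)
  also have "\<dots> = (\<Sum>a<d i. \<Sum>t\<in>stubs n d. of_bool ({(i, a), t} \<in> P))"
    by (simp add: sum_stubs)
  also have "\<dots> = (\<Sum>a<d i. 1)"
    using assms by (intro sum.cong refl pairing_sum_partner) (auto simp: stubs_def)
  finally show ?thesis by simp
qed

lemma stub_adj_commute: "stub_adj d P i j = stub_adj d P j i"
  unfolding stub_adj_def by (subst sum.swap) (simp add: insert_commute)

lemma erased_adj_eq:
  assumes P: "P \<in> pairings (stubs n d)"
  shows "erased_adj P i j = of_bool (i \<noteq> j \<and> 0 < stub_adj d P i j)"
proof -
  have fin: "finite P"
    using P finite_pairings by (auto simp: pairings_def partition_on_def intro: finite_elements[OF finite_stubs[of n d]])
  have "0 < edge_count P i j \<longleftrightarrow> (\<exists>s t. {(i, s), (j, t)} \<in> P)"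
    using fin by (auto simp: edge_count_def card_gt_0_iff)
  also have "\<dots> \<longleftrightarrow> (\<exists>s<d i. \<exists>t<d j. {(i, s), (j, t)} \<in> P)"
  proof -
    have "s < d i \<and> t < d j" if "{(i, s), (j, t)} \<in> P" for s t
      using pairing_edge(1,2)[OF P that] by (simp add: stubs_def)
    then show ?thesis by blast
  qed
  also have "\<dots> \<longleftrightarrow> 0 < stub_adj d P i j"
    unfolding stub_adj_def neq0_conv[symmetric] by auto
  finally show ?thesis
    by (simp add: erased_adj_def Suc_le_eq)
qed

lemma erased_adj_commute: "erased_adj P i j = erased_adj P j i"
proof -
  have "(\<exists>s t. e = {(i, s), (j, t)}) \<longleftrightarrow> (\<exists>s t. e = {(j, s), (i, t)})" for e :: "(nat \<times> nat) set"
    by (metis insert_commute)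
  then show ?thesis
    unfolding erased_adj_def edge_count_def by (simp only: eq_commute[of i j])
qed

lemma erased_adj_le: "P \<in> pairings (stubs n d) \<Longrightarrow> erased_adj P i j \<le> stub_adj d P i j"
  by (simp add: erased_adj_eq)

lemma erased_degree_le:
  assumes "P \<in> pairings (stubs n d)" and "i \<in> {1..n}"
  shows "erased_degree n P i \<le> d i"
  unfolding erased_degree_def sum_stub_adj[OF assms, symmetric]
  by (intro sum_mono erased_adj_le[OF assms(1)])

section \<open>Expected multiple edges and loops\<close>

text \<open>The difference of the two expectations is the mean number of ordered pairs of distinct
  parallel edges between \<open>i\<close> and \<open>j\<close>. Such edges are disjoint as sets of
  stubs, so the two-edge probability bounds it.\<close>

lemma expectation_stub_adj_square_le:
  assumes ev: "even (total_degree n d)" and L: "4 \<le> total_degree n d"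
    and ij: "i \<in> {1..n}" "j \<in> {1..n}" "i \<noteq> j"
  defines "L \<equiv> real (total_degree n d)"
  defines "E \<equiv> measure_pmf.expectation (pmf_of_set (pairings (stubs n d)))"
  shows "E (\<lambda>P. (real (stub_adj d P i j))\<^sup>2)
    \<le> E (\<lambda>P. real (stub_adj d P i j)) + (real (d i) * real (d j))\<^sup>2 / ((L - 1) * (L - 3))"
proof -
  define W where "W = (\<lambda>x :: (nat \<times> nat) \<times> (nat \<times> nat). of_bool (fst (fst x) = i \<and> fst (snd x) = j) :: real)"
  have del: "(\<Sum>i'=1..n. \<Sum>j'=1..n. of_bool (i' = i \<and> j' = j) * f i' j') = f i j" for f :: "nat \<Rightarrow> nat \<Rightarrow> real"
  proof -
    have "(\<Sum>i'=1..n. \<Sum>j'=1..n. of_bool (i' = i \<and> j' = j) * f i' j')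
      = (\<Sum>i'=1..n. if i' = i then (\<Sum>j'=1..n. if j' = j then f i j' else 0) else 0)"
      by (intro sum.cong refl) (auto intro!: sum.cong sum.neutral)
    then show ?thesis using ij by simp
  qed
  have adj: "(\<Sum>x\<in>stubs n d \<times> stubs n d. W x * of_bool ({fst x, snd x} \<in> P)) = real (stub_adj d P i j)" for P
    unfolding W_def by (subst sum_stub_pairs) (rule del)
  have sumW: "(\<Sum>x\<in>stubs n d \<times> stubs n d. W x) = real (d i) * real (d j)"
  proof -
    have marg: "(\<Sum>s\<in>stubs n d. of_bool (fst s = m)) = real (d m)" if "m \<in> {1..n}" for m
    proof -
      have "(\<Sum>s\<in>stubs n d. of_bool (fst s = m)) = (\<Sum>i=1..n. if i = m then real (d i) else 0)"
        unfolding sum_stubs by (intro sum.cong) auto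
      then show ?thesis using that by simp
    qed
    have "(\<Sum>x\<in>stubs n d \<times> stubs n d. W x)
        = (\<Sum>s\<in>stubs n d. \<Sum>t\<in>stubs n d. of_bool (fst s = i) * of_bool (fst t = j))"
      unfolding sum.cartesian_product W_def by (intro sum.cong refl) auto
    also have "\<dots> = (\<Sum>s\<in>stubs n d. of_bool (fst s = i)) * (\<Sum>t\<in>stubs n d. of_bool (fst t = j))"
      unfolding sum_product ..
    also have "\<dots> = real (d i) * real (d j)" by (simp only: marg ij(1,2))
    finally show ?thesis .
  qed
  \<comment> \<open>Since \<open>i \<noteq> j\<close>, the weight selects one orientation: a pair
    and its swap never both count. The single sum of the second moment bound is thus exactly the
    edge count.\<close>
  have WW: "W x * W x + W x * W (prod.swap x) = W x" for x
    using ij(3) by (auto simp: W_def)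
  show ?thesis
    using expectation_edge_sum_square_le[of "stubs n d" W] ev L
    unfolding WW adj sumW card_stubs E_def L_def by (simp add: W_def)
qed

lemma expectation_stub_loops_le:
  assumes ev: "even (total_degree n d)" and L: "2 \<le> total_degree n d"
    and i: "i \<in> {1..n}"
  defines "L \<equiv> real (total_degree n d)"
  defines "E \<equiv> measure_pmf.expectation (pmf_of_set (pairings (stubs n d)))"
  shows "E (\<lambda>P. real (stub_adj d P i i)) \<le> (real (d i))\<^sup>2 / (L - 1)"
proof -
  have int: "integrable (measure_pmf (pmf_of_set (pairings (stubs n d)))) f" for f :: "_ \<Rightarrow> real"
    using ev by (intro integrable_pairings) (auto simp: card_stubs)
  have mem: "(m, a) \<in> stubs n d \<longleftrightarrow> m \<in> {1..n} \<and> a < d m" for m a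
    by (simp add: stubs_def)
  have edge: "E (\<lambda>P. of_bool ({(i, a), (i, b)} \<in> P)) \<le> 1 / (L - 1)" if "a < d i" "b < d i" for a b
  proof (cases "a = b")
    case True
    have "{(i, a), (i, a)} \<notin> P" if "P \<in> pairings (stubs n d)" for P
      using pairing_edge(3)[OF that] by blast
    then have "E (\<lambda>P. of_bool ({(i, a), (i, b)} \<in> P)) = 0"
      using ev True by (simp add: E_def expectation_pairings card_stubs del: insert_absorb2)
    then show ?thesis using L by (simp add: L_def)
  next
    case False
    then show ?thesis
      using expectation_edge[of "stubs n d" "(i, a)" "(i, b)"] ev
      unfolding E_def L_def card_stubs using i False by (simp add: mem that)
  qed
  have "E (\<lambda>P. real (stub_adj d P i i)) = (\<Sum>a<d i. \<Sum>b<d i. E (\<lambda>P. of_bool ({(i, a), (i, b)} \<in> P)))"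
    unfolding stub_adj_def E_def of_nat_sum of_nat_of_bool
    by (simp only: Bochner_Integration.integral_sum int)
  also have "\<dots> \<le> (\<Sum>a<d i. \<Sum>b<d i. 1 / (L - 1))"
    using edge by (intro sum_mono) auto
  finally show ?thesis by (simp add: power2_eq_square)
qed

lemma sum_erased_degree:
  assumes "P \<in> pairings (stubs n d)"
  shows "real (total_degree n d) - real (total_degree n (erased_degree n P))
    = (\<Sum>i=1..n. \<Sum>j=1..n. real (stub_adj d P i j) - real (erased_adj P i j))"
proof -
  have "real (total_degree n d) = (\<Sum>i=1..n. \<Sum>j=1..n. real (stub_adj d P i j))"
    unfolding total_degree_def of_nat_sum
    by (intro sum.cong refl) (metis sum_stub_adj[OF assms] of_nat_sum)
  then show ?thesis
    by (simp add: total_degree_def erased_degree_def sum_subtractf)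
qed

text \<open>Truncation at degree \<open>M\<close>: stubs at or next to a node of larger degree are given up, and
  between nodes of degree at most \<open>M\<close> the bound \<open>G - 1 \<le> G\<^sup>2 - G\<close> for a positive edge count \<open>G\<close>
  reduces multiple edges to the second moment.\<close>

lemma expectation_erased_le:
  assumes ev: "even (total_degree n d)" and L: "4 \<le> total_degree n d"
  defines "E \<equiv> measure_pmf.expectation (pmf_of_set (pairings (stubs n d)))"
  shows "E (\<lambda>P. real (total_degree n d) - real (total_degree n (erased_degree n P)))
    \<le> 2 * (\<Sum>i=1..n. real (d i) * of_bool (M < d i)) + 2 * real M + 6 * (real M)\<^sup>2"
proof -
  define L where "L = real (total_degree n d)"
  define G where "G = (\<lambda>P i j. real (stub_adj d P i j))"
  have L4: "4 \<le> L" using L by (simp add: L_def)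
  have Lsum: "L = (\<Sum>i=1..n. real (d i))" by (simp add: L_def total_degree_def)
  have int: "integrable (measure_pmf (pmf_of_set (pairings (stubs n d)))) f" for f :: "_ \<Rightarrow> real"
    using ev by (intro integrable_pairings) (auto simp: card_stubs)
  define B where "B = (\<lambda>P. \<Sum>i=1..n. \<Sum>j=1..n. of_bool (d i \<le> M \<and> d j \<le> M) *
     (of_bool (i = j) * G P i j + of_bool (i \<noteq> j) * ((G P i j)\<^sup>2 - G P i j)))"
  have pt: "real (total_degree n d) - real (total_degree n (erased_degree n P))
      \<le> 2 * (\<Sum>i=1..n. real (d i) * of_bool (M < d i)) + B P" if P: "P \<in> pairings (stubs n d)" for P
  proof -
    have sq: "real m - of_bool (0 < m) \<le> (real m)\<^sup>2 - real m" for m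
    proof (cases "m = 0")
      case False
      then have "0 \<le> (real m - 1) * (real m - 1)" by simp
      then show ?thesis using False by (simp add: algebra_simps power2_eq_square)
    qed simp
    have "real (stub_adj d P i j) - real (erased_adj P i j)
      \<le> of_bool (M < d i) * G P i j + of_bool (M < d j) * G P i j
        + of_bool (d i \<le> M \<and> d j \<le> M) *
     (of_bool (i = j) * G P i j + of_bool (i \<noteq> j) * ((G P i j)\<^sup>2 - G P i j))" for i j
      using sq[of "stub_adj d P i j"] by (auto simp: erased_adj_eq[OF P] G_def not_less of_bool_def)
    then have "real (total_degree n d) - real (total_degree n (erased_degree n P))
      \<le> (\<Sum>i=1..n. \<Sum>j=1..n. of_bool (M < d i) * G P i j + of_bool (M < d j) * G P i j
        + of_bool (d i \<le> M \<and> d j \<le> M) *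
     (of_bool (i = j) * G P i j + of_bool (i \<noteq> j) * ((G P i j)\<^sup>2 - G P i j)))"
      unfolding sum_erased_degree[OF P] by (intro sum_mono)
    also have "\<dots> = (\<Sum>i=1..n. \<Sum>j=1..n. of_bool (M < d i) * G P i j)
        + (\<Sum>i=1..n. \<Sum>j=1..n. of_bool (M < d j) * G P i j) + B P"
      by (simp add: sum.distrib B_def)
    also have "(\<Sum>i=1..n. \<Sum>j=1..n. of_bool (M < d j) * G P i j) = (\<Sum>i=1..n. \<Sum>j=1..n. of_bool (M < d i) * G P i j)"
      by (subst sum.swap) (simp add: G_def stub_adj_commute)
    also have "\<dots> = (\<Sum>i=1..n. real (d i) * of_bool (M < d i))"
    proof (intro sum.cong refl)
      fix i assume "i \<in> {1..n}"
      then have "(\<Sum>j=1..n. G P i j) = real (d i)"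
        using sum_stub_adj[OF P] by (simp add: G_def flip: of_nat_sum)
      then show "(\<Sum>j=1..n. of_bool (M < d i) * G P i j) = real (d i) * of_bool (M < d i)"
        by (simp flip: sum_distrib_left)
    qed
    finally show ?thesis by simp
  qed
  have pair: "of_bool (d i \<le> M \<and> d j \<le> M) *
     (of_bool (i = j) * E (\<lambda>P. G P i j) + of_bool (i \<noteq> j) * (E (\<lambda>P. (G P i j)\<^sup>2) - E (\<lambda>P. G P i j)))
     \<le> of_bool (i = j) * (real M * real (d i) / (L - 1))
        + (real M)\<^sup>2 * (real (d i) * real (d j)) / ((L - 1) * (L - 3))"
    if ij: "i \<in> {1..n}" "j \<in> {1..n}" for i j
  proof (cases "d i \<le> M \<and> d j \<le> M")
    case True
    show ?thesis
    proof (cases "i = j")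
      case eq: True
      have "E (\<lambda>P. G P i j) \<le> (real (d i))\<^sup>2 / (L - 1)"
        using expectation_stub_loops_le[OF ev _ ij(1)] L eq by (simp add: E_def G_def L_def)
      also have "\<dots> \<le> real M * real (d i) / (L - 1)"
        using True L4 by (intro divide_right_mono) (auto simp: power2_eq_square intro!: mult_right_mono)
      finally have "E (\<lambda>P. G P i j) \<le> real M * real (d i) / (L - 1)" .
      moreover have "0 \<le> (real M)\<^sup>2 * (real (d i) * real (d j)) / ((L - 1) * (L - 3))"
        using L4 by simp
      ultimately have "E (\<lambda>P. G P i j) \<le> real M * real (d i) / (L - 1)
          + (real M)\<^sup>2 * (real (d i) * real (d j)) / ((L - 1) * (L - 3))" by linarith
      then show ?thesis using True eq by simp
    next
      case ne: False
      have "E (\<lambda>P. (G P i j)\<^sup>2) - E (\<lambda>P. G P i j) \<le> (real (d i) * real (d j))\<^sup>2 / ((L - 1) * (L - 3))"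
        using expectation_stub_adj_square_le[OF ev L ij ne] by (simp add: E_def G_def L_def)
      \<comment> \<open>Only one of the two factors \<open>d i * d j\<close> is bounded by
        \<open>M\<^sup>2\<close>. The other is kept, so that the double sum becomes
        \<open>L\<^sup>2\<close> and compensates the denominator.\<close>
      also have "\<dots> \<le> (real M)\<^sup>2 * (real (d i) * real (d j)) / ((L - 1) * (L - 3))"
      proof (intro divide_right_mono)
        have "real (d i) * real (d j) \<le> real M * real M"
          using True by (intro mult_mono) auto
        then show "(real (d i) * real (d j))\<^sup>2 \<le> (real M)\<^sup>2 * (real (d i) * real (d j))"
          unfolding power2_eq_square by (intro mult_right_mono) auto
      qed (use L4 in auto)
      finally show ?thesis using True ne by simp
    qed
  next
    case False
    then show ?thesis using L4 by (auto intro!: add_nonneg_nonneg)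
  qed
  have "E (\<lambda>P. real (total_degree n d) - real (total_degree n (erased_degree n P)))
    \<le> E (\<lambda>P. 2 * (\<Sum>i=1..n. real (d i) * of_bool (M < d i)) + B P)"
    unfolding E_def
  proof (rule integral_mono_AE[OF int int], rule AE_pmfI)
    fix P assume "P \<in> set_pmf (pmf_of_set (pairings (stubs n d)))"
    then have "P \<in> pairings (stubs n d)"
      using ev by (simp add: finite_pairings pairings_nonempty card_stubs)
    then show "real (total_degree n d) - real (total_degree n (erased_degree n P))
      \<le> 2 * (\<Sum>i=1..n. real (d i) * of_bool (M < d i)) + B P" by (rule pt)
  qed
  also have "\<dots> = 2 * (\<Sum>i=1..n. real (d i) * of_bool (M < d i)) + E B"
    unfolding E_def by (subst Bochner_Integration.integral_add[OF int int]) simp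
  also have "E B = (\<Sum>i=1..n. \<Sum>j=1..n. of_bool (d i \<le> M \<and> d j \<le> M) *
     (of_bool (i = j) * E (\<lambda>P. G P i j) + of_bool (i \<noteq> j) * (E (\<lambda>P. (G P i j)\<^sup>2) - E (\<lambda>P. G P i j))))"
    unfolding B_def E_def
    by (simp only: Bochner_Integration.integral_sum Bochner_Integration.integral_add
        Bochner_Integration.integral_diff integral_mult_right_zero int)
  also have "\<dots> \<le> (\<Sum>i=1..n. \<Sum>j=1..n. of_bool (i = j) * (real M * real (d i) / (L - 1))
        + (real M)\<^sup>2 * (real (d i) * real (d j)) / ((L - 1) * (L - 3)))"
    by (intro sum_mono pair)
  also have "\<dots> = (\<Sum>i=1..n. \<Sum>j=1..n. of_bool (i = j) * (real M * real (d i) / (L - 1)))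
      + (\<Sum>i=1..n. \<Sum>j=1..n. (real M)\<^sup>2 * (real (d i) * real (d j)) / ((L - 1) * (L - 3)))"
    by (simp add: sum.distrib)
  also have "(\<Sum>i=1..n. \<Sum>j=1..n. of_bool (i = j) * (real M * real (d i) / (L - 1))) = real M * (L / (L - 1))"
  proof -
    have "(\<Sum>j=1..n. of_bool (i = j) * (real M * real (d i) / (L - 1))) = real M * real (d i) / (L - 1)"
      if "i \<in> {1..n}" for i
      using that by (simp add: of_bool_def if_distrib if_distribR cong: if_cong)
    then have "(\<Sum>i=1..n. \<Sum>j=1..n. of_bool (i = j) * (real M * real (d i) / (L - 1)))
        = (\<Sum>i=1..n. real M * real (d i) / (L - 1))"
      by (intro sum.cong refl)
    then show ?thesis by (simp add: Lsum sum_divide_distrib sum_distrib_left)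
  qed
  also have "(\<Sum>i=1..n. \<Sum>j=1..n. (real M)\<^sup>2 * (real (d i) * real (d j)) / ((L - 1) * (L - 3)))
      = (real M)\<^sup>2 * (L * L / ((L - 1) * (L - 3)))"
    unfolding Lsum sum_product by (simp add: sum_distrib_left sum_divide_distrib)
  also have "real M * (L / (L - 1)) \<le> real M * 2"
    using L4 by (intro mult_left_mono) (auto simp: field_simps)
  \<comment> \<open>For \<open>L \<ge> 4\<close> the two quotients are at most \<open>4 / 3\<close>
    and \<open>4\<close>, with product \<open>16 / 3\<close>.\<close>
  also have "(real M)\<^sup>2 * (L * L / ((L - 1) * (L - 3))) \<le> (real M)\<^sup>2 * 6"
  proof (intro mult_left_mono)
    have "L / (L - 1) \<le> 4 / 3" "L / (L - 3) \<le> 4" using L4 by (auto simp: field_simps)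
    then have "L / (L - 1) * (L / (L - 3)) \<le> 4 / 3 * 4" using L4 by (intro mult_mono) auto
    then show "L * L / ((L - 1) * (L - 3)) \<le> 6" unfolding times_divide_times_eq by linarith
  qed simp
  finally show ?thesis by simp
qed

section \<open>Stability of the rank under erasure\<close>

text \<open>The total degree divides both the joint density and the size-biased density and cancels;
  it survives only inside \<open>empirical_sb_cdf\<close>. If no node has degree \<open>k\<close>,
  the right-hand side is a division by 0 and agrees with the default value 0.\<close>

lemma annr_eq:
  assumes deg: "\<And>i. i \<in> {1..n} \<Longrightarrow> d i = (\<Sum>j=1..n. A i j)"
    and sym: "\<And>i j. A i j = A j i" and k: "0 < k"
  shows "annr n A d k = (\<Sum>i=1..n. \<Sum>j=1..n. real (A i j) * of_bool (d i = k) * empirical_sb_cdf n d (d j))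
    / (real k * (\<Sum>i=1..n. of_bool (d i = k)))"
proof (cases "\<exists>i\<in>{1..n}. d i = k")
  case False
  then have "(\<Sum>i=1..n. of_bool (d i = k) :: real) = 0" by (intro sum.neutral) auto
  then show ?thesis by (simp only: annr_def empirical_density_def) simp
next
  case True
  then obtain i0 where i0: "i0 \<in> {1..n}" "d i0 = k" by blast
  define N where "N = (\<Sum>i=1..n. of_bool (d i = k) :: real)"
  define L where "L = real (total_degree n d)"
  define C where "C = empirical_sb_cdf n d"
  define T where "T = d ` {1..n} \<inter> {0<..}"
  have "of_bool (d i0 = k) \<le> N"
    unfolding N_def using i0(1) by (intro member_le_sum) auto
  then have N: "0 < N" using i0 by simp
  have "d i0 \<le> total_degree n d"
    unfolding total_degree_def using i0(1) by (intro member_le_sum) auto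
  then have L: "0 < L" using i0 k by (simp add: L_def)
  have n: "0 < n" using i0 by auto
  have dens: "0 < empirical_density n d k"
    using N n by (simp add: empirical_density_def N_def)
  \<comment> \<open>By symmetry a neighbour has positive degree itself, so summing over
    \<open>l > 0\<close> misses no edge.\<close>
  have inT: "d j \<in> T" if "i \<in> {1..n}" "j \<in> {1..n}" "A i j \<noteq> 0" for i j
  proof -
    have "A j i \<le> d j" unfolding deg[OF that(2)] using that(1) by (intro member_le_sum) auto
    then show ?thesis using that sym[of i j] by (auto simp: T_def)
  qed
  have "(\<Sum>\<^sub>\<infinity>l\<in>{0<..}. empirical_joint_density n A d k l * C l)
      = (\<Sum>\<^sub>\<infinity>l\<in>T. empirical_joint_density n A d k l * C l)"
  proof (rule infsum_cong_neutral)
    fix l assume l: "l \<in> {0<..} - T"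
    have "real (A i j) * of_bool (d i = k \<and> d j = l) = 0" if "i \<in> {1..n}" "j \<in> {1..n}" for i j
      using inT[OF that] l by auto
    then have "empirical_joint_density n A d k l = 0"
      unfolding empirical_joint_density_def by (simp only: sum.neutral_const div_0 cong: sum.cong)
    then show "empirical_joint_density n A d k l * C l = 0" by simp
  qed (auto simp: T_def)
  also have "\<dots> = (\<Sum>l\<in>T. empirical_joint_density n A d k l * C l)"
    by (rule infsum_finite) (simp add: T_def)
  also have "\<dots> = (\<Sum>l\<in>T. \<Sum>i=1..n. \<Sum>j=1..n. real (A i j) * of_bool (d i = k \<and> d j = l) * C l) / L"
    by (simp only: empirical_joint_density_def L_def[symmetric] sum_divide_distrib sum_distrib_right
        times_divide_eq_left)
  also have "(\<Sum>l\<in>T. \<Sum>i=1..n. \<Sum>j=1..n. real (A i j) * of_bool (d i = k \<and> d j = l) * C l)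
      = (\<Sum>i=1..n. \<Sum>j=1..n. \<Sum>l\<in>T. real (A i j) * of_bool (d i = k \<and> d j = l) * C l)"
    by (simp only: sum.swap[where A = T])
  also have "\<dots> = (\<Sum>i=1..n. \<Sum>j=1..n. real (A i j) * of_bool (d i = k) * C (d j))"
  proof (intro sum.cong refl)
    fix i j assume ij: "i \<in> {1..n}" "j \<in> {1..n}"
    have "(\<Sum>l\<in>T. real (A i j) * of_bool (d i = k \<and> d j = l) * C l)
        = (\<Sum>l\<in>T. if l = d j then real (A i j) * of_bool (d i = k) * C (d j) else 0)"
      by (intro sum.cong) auto
    also have "\<dots> = real (A i j) * of_bool (d i = k) * C (d j)"
      using inT[OF ij] by (cases "A i j = 0") (simp_all add: T_def)
    finally show "(\<Sum>l\<in>T. real (A i j) * of_bool (d i = k \<and> d j = l) * C l)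
        = real (A i j) * of_bool (d i = k) * C (d j)" .
  qed
  finally have num: "(\<Sum>\<^sub>\<infinity>l\<in>{0<..}. empirical_joint_density n A d k l * C l)
      = (\<Sum>i=1..n. \<Sum>j=1..n. real (A i j) * of_bool (d i = k) * C (d j)) / L" .
  have "empirical_sb_density n d k = real k * N / L"
    unfolding empirical_sb_density_def N_def L_def sum_distrib_left ..
  then show ?thesis
    using dens num L by (simp add: annr_def C_def N_def)
qed

text \<open>\<open>h\<close> stands for the erased degrees; \<open>E\<close> counts the erased stubs and \<open>R\<close> the stubs at nodes of
  degree larger than \<open>M\<close>.\<close>

lemma
  fixes d h :: "nat \<Rightarrow> nat" and n M :: nat
  assumes hd: "\<And>i. i \<in> {1..n} \<Longrightarrow> h i \<le> d i"
  defines "E \<equiv> real (total_degree n d) - real (total_degree n h)"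
    and "R \<equiv> \<Sum>i=1..n. real (d i) * of_bool (M < d i)"
  shows sum_changed_le: "(\<Sum>i=1..n. of_bool (h i \<noteq> d i)) \<le> E"
    and sum_changed_degree_le: "(\<Sum>i=1..n. real (d i) * of_bool (h i \<noteq> d i)) \<le> real M * E + R"
    and empirical_sb_cdf_diff_le: "0 < total_degree n d \<Longrightarrow>
      \<bar>empirical_sb_cdf n h l - empirical_sb_cdf n d l\<bar> \<le> ((real M + 1) * E + R) / real (total_degree n d)"
proof -
  have E: "E = (\<Sum>i=1..n. real (d i) - real (h i))"
    by (simp add: E_def total_degree_def sum_subtractf)
  show 1: "(\<Sum>i=1..n. of_bool (h i \<noteq> d i)) \<le> E"
    unfolding E
  proof (intro sum_mono)
    fix i assume "i \<in> {1..n}"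
    then show "of_bool (h i \<noteq> d i) \<le> real (d i) - real (h i)" using hd[of i] by auto
  qed
  \<comment> \<open>A changed node has lost at least one stub. If its degree is at most
    \<open>M\<close>, the degree is paid for by \<open>M\<close> times the loss; otherwise it is
    part of \<open>R\<close>.\<close>
  have "real (d i) * of_bool (h i \<noteq> d i) \<le> real M * (real (d i) - real (h i)) + real (d i) * of_bool (M < d i)"
    if "i \<in> {1..n}" for i
  proof -
    have "real (d i) * of_bool (h i \<noteq> d i) \<le> real M * of_bool (h i \<noteq> d i) + real (d i) * of_bool (M < d i)"
      by auto
    also have "real M * of_bool (h i \<noteq> d i) \<le> real M * (real (d i) - real (h i))"
      using hd[OF that] by (intro mult_left_mono) auto
    finally show ?thesis by simp
  qed
  then have "(\<Sum>i=1..n. real (d i) * of_bool (h i \<noteq> d i))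
      \<le> (\<Sum>i=1..n. real M * (real (d i) - real (h i)) + real (d i) * of_bool (M < d i))"
    by (intro sum_mono)
  also have "\<dots> = real M * E + R"
    by (simp only: sum.distrib sum_distrib_left E R_def)
  finally show 2: "(\<Sum>i=1..n. real (d i) * of_bool (h i \<noteq> d i)) \<le> real M * E + R" .
  define H where "H = real (total_degree n h)"
  define L where "L = real (total_degree n d)"
  assume "0 < total_degree n d"
  then have L: "0 < L" by (simp add: L_def)
  have H: "0 \<le> H" "H \<le> L"
    using hd by (auto simp: H_def L_def total_degree_def intro!: sum_mono simp flip: of_nat_sum)
  define a where "a = (\<Sum>i=1..n. real (h i) * of_bool (h i \<le> l))"
  define b where "b = (\<Sum>i=1..n. real (d i) * of_bool (d i \<le> l))"
  have a: "0 \<le> a" "a \<le> H"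
    unfolding a_def H_def total_degree_def of_nat_sum
    by (rule sum_nonneg, simp) (rule sum_mono, simp)
  have "a - b = (\<Sum>i=1..n. real (h i) * of_bool (h i \<le> l) - real (d i) * of_bool (d i \<le> l))"
    by (simp add: a_def b_def sum_subtractf del: sum_mult_of_bool_eq)
  then have "\<bar>a - b\<bar> \<le> (\<Sum>i=1..n. \<bar>real (h i) * of_bool (h i \<le> l) - real (d i) * of_bool (d i \<le> l)\<bar>)"
    by (simp only: sum_abs)
  also have "\<dots> \<le> (\<Sum>i=1..n. real (d i) * of_bool (h i \<noteq> d i))"
  proof (intro sum_mono)
    fix i assume "i \<in> {1..n}"
    then show "\<bar>real (h i) * of_bool (h i \<le> l) - real (d i) * of_bool (d i \<le> l)\<bar>
        \<le> real (d i) * of_bool (h i \<noteq> d i)"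
      using hd[of i] by (cases "h i = d i") auto
  qed
  also note 2
  finally have ab: "\<bar>a / L - b / L\<bar> \<le> (real M * E + R) / L"
    using L by (simp add: abs_divide divide_right_mono flip: diff_divide_distrib)
  \<comment> \<open>The effect of the changed normalisation alone. If \<open>H = 0\<close> then also
    \<open>a = 0\<close> and both quotients vanish; otherwise \<open>a / H \<le> 1\<close>.\<close>
  have "\<bar>a / H - a / L\<bar> \<le> E / L"
  proof (cases "H = 0")
    case True
    then show ?thesis using a H L by (simp add: E_def H_def[symmetric] L_def[symmetric])
  next
    case False
    then have H0: "0 < H" using H by simp
    have "a / H - a / L = (a / H) * ((L - H) / L)"
      using H0 L by (simp add: field_simps)
    also have "\<bar>\<dots>\<bar> \<le> 1 * ((L - H) / L)"
      unfolding abs_mult using a H H0 L by (intro mult_mono) (auto simp: abs_divide divide_le_eq)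
    finally show ?thesis by (simp add: E_def H_def L_def)
  qed
  with ab have "\<bar>a / H - b / L\<bar> \<le> (real M * E + R) / L + E / L" by linarith
  also have "\<dots> = ((real M + 1) * E + R) / L" by (simp add: algebra_simps add_divide_distrib)
  finally show "\<bar>empirical_sb_cdf n h l - empirical_sb_cdf n d l\<bar> \<le> ((real M + 1) * E + R) / real (total_degree n d)"
    by (simp only: empirical_sb_cdf_def a_def b_def H_def L_def)
qed

text \<open>Monotonicity reduces uniform closeness of the distribution functions to the finitely many
  values up to \<open>M\<close> and the two tails.\<close>

lemma empirical_sb_cdf_uniform:
  fixes F :: "nat \<Rightarrow> real"
  assumes L: "0 < total_degree n d" and F: "mono F" "\<And>x. 0 \<le> F x" "\<And>x. F x \<le> 1"
  shows "\<bar>empirical_sb_cdf n d l - F l\<bar>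
    \<le> (\<Sum>m\<le>M. \<bar>empirical_sb_cdf n d m - F m\<bar>)
      + (\<Sum>i=1..n. real (d i) * of_bool (M < d i)) / real (total_degree n d) + (1 - F M)"
proof (cases "l \<le> M")
  case True
  have "\<bar>empirical_sb_cdf n d l - F l\<bar> \<le> (\<Sum>m\<le>M. \<bar>empirical_sb_cdf n d m - F m\<bar>)"
    using True by (intro member_le_sum) auto
  moreover have "0 \<le> (\<Sum>i=1..n. real (d i) * of_bool (M < d i)) / real (total_degree n d)"
    by (intro divide_nonneg_nonneg sum_nonneg) auto
  ultimately show ?thesis using F(3)[of M] by linarith
next
  case False
  let ?L = "real (total_degree n d)"
  have le1: "empirical_sb_cdf n d l \<le> 1"
  proof -
    have "(\<Sum>i=1..n. real (d i) * of_bool (d i \<le> l)) \<le> ?L"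
      unfolding total_degree_def of_nat_sum by (rule sum_mono) simp
    then show ?thesis
      using L unfolding empirical_sb_cdf_def by (simp only: divide_le_eq_1_pos of_nat_0_less_iff)
  qed
  have "1 - (\<Sum>i=1..n. real (d i) * of_bool (M < d i)) / ?L
      = (\<Sum>i=1..n. real (d i) - real (d i) * of_bool (M < d i)) / ?L"
  proof -
    have "?L / ?L = 1" using L by simp
    then show ?thesis
      by (simp only: sum_subtractf diff_divide_distrib total_degree_def of_nat_sum)
  qed
  also have "\<dots> \<le> empirical_sb_cdf n d l"
    unfolding empirical_sb_cdf_def using False by (intro divide_right_mono sum_mono) auto
  finally have ge: "1 - (\<Sum>i=1..n. real (d i) * of_bool (M < d i)) / ?L \<le> empirical_sb_cdf n d l" .
  have "F M \<le> F l" using F(1) False by (simp add: monoD)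
  moreover have "0 \<le> (\<Sum>m\<le>M. \<bar>empirical_sb_cdf n d m - F m\<bar>)" by (simp add: sum_nonneg)
  moreover have "0 \<le> (\<Sum>i=1..n. real (d i) * of_bool (M < d i)) / ?L"
    by (intro divide_nonneg_nonneg sum_nonneg) auto
  ultimately show ?thesis
    using ge le1 F(3)[of l] F(3)[of M] by linarith
qed

text \<open>The distribution function is evaluated at the degrees of neighbours, hence the uniform
  bound \<open>\<eta>\<close>. Origin of the coefficient of \<open>E / L\<close>: \<open>k\<close>
  from nodes entering or leaving degree \<open>k\<close>, \<open>M + 1\<close> from
  \<open>\<eta>\<close>, \<open>M\<close> from neighbours with a changed degree, \<open>1\<close>
  from lost edges. The tail \<open>R\<close> enters three times: twice through \<open>\<eta>\<close>
  and once through changed neighbours.\<close>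

lemma erased_neighbour_sum_close:
  fixes F :: "nat \<Rightarrow> real" and M k :: nat
  assumes P: "P \<in> pairings (stubs n d)" and L: "0 < total_degree n d"
    and F: "mono F" "\<And>x. 0 \<le> F x" "\<And>x. F x \<le> 1"
  defines "h \<equiv> erased_degree n P"
  defines "L \<equiv> real (total_degree n d)"
  defines "E \<equiv> L - real (total_degree n h)"
    and "R \<equiv> \<Sum>i=1..n. real (d i) * of_bool (M < d i)"
  shows "\<bar>(\<Sum>i=1..n. \<Sum>j=1..n. real (erased_adj P i j) * of_bool (h i = k) * empirical_sb_cdf n h (h j)) / L
      - (\<Sum>i=1..n. \<Sum>j=1..n. real (stub_adj d P i j) * of_bool (d i = k) * F (d j)) / L\<bar>
    \<le> (real k + 2 * real M + 2) * (E / L) + 3 * (R / L)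
      + (\<Sum>m\<le>M. \<bar>empirical_sb_cdf n d m - F m\<bar>) + (1 - F M)"
proof -
  let ?A = "\<lambda>i j. real (erased_adj P i j)" and ?G = "\<lambda>i j. real (stub_adj d P i j)"
  let ?C = "empirical_sb_cdf n h"
  define \<eta> where "\<eta> = ((real M + 1) * E + R) / L + ((\<Sum>m\<le>M. \<bar>empirical_sb_cdf n d m - F m\<bar>) + R / L + (1 - F M))"
  have L0: "0 < L" using L by (simp add: L_def)
  have hd: "h i \<le> d i" if "i \<in> {1..n}" for i
    unfolding h_def by (rule erased_degree_le[OF P that])
  have rowA: "(\<Sum>j=1..n. ?A i j) = real (h i)" for i
    by (simp add: h_def erased_degree_def)
  have \<eta>: "\<bar>?C l - F l\<bar> \<le> \<eta>" for l
    using empirical_sb_cdf_diff_le[OF hd L, where M = M and l = l] empirical_sb_cdf_uniform[OF L F, where M = M and l = l]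
    unfolding \<eta>_def E_def R_def L_def by linarith
  have \<eta>0: "0 \<le> \<eta>" using \<eta>[of 0] by linarith
  have ch: "(\<Sum>i=1..n. of_bool (h i \<noteq> d i)) \<le> E"
    using sum_changed_le[OF hd] by (simp only: E_def L_def)
  have chd: "(\<Sum>i=1..n. real (d i) * of_bool (h i \<noteq> d i)) \<le> real M * E + R"
    using sum_changed_degree_le[OF hd] by (simp only: E_def L_def R_def)
  have pt: "\<bar>?A i j * of_bool (h i = k) * ?C (h j) - ?G i j * of_bool (d i = k) * F (d j)\<bar>
      \<le> ?A i j * \<bar>of_bool (h i = k) - of_bool (d i = k)\<bar> + ?A i j * (\<eta> + of_bool (h j \<noteq> d j)) + (?G i j - ?A i j)"
    for i j
  proof -
    define x y :: real where "x = of_bool (h i = k)" and "y = of_bool (d i = k)"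
    have xy: "0 \<le> x" "x \<le> 1" "0 \<le> y" "y \<le> 1" by (auto simp: x_def y_def)
    have AG: "?A i j \<le> ?G i j" using erased_adj_le[OF P] by simp
    \<comment> \<open>The three factors are exchanged one at a time: first the distribution
      function, then the indicator, last the edge count.\<close>
    have "?A i j * x * ?C (h j) - ?G i j * y * F (d j)
        = ?A i j * (x * (?C (h j) - F (d j))) + ?A i j * ((x - y) * F (d j)) - (?G i j - ?A i j) * (y * F (d j))"
      by (simp add: algebra_simps)
    also have "\<bar>\<dots>\<bar> \<le> \<bar>?A i j * (x * (?C (h j) - F (d j)))\<bar> + \<bar>?A i j * ((x - y) * F (d j))\<bar>
        + \<bar>(?G i j - ?A i j) * (y * F (d j))\<bar>"
      by linarith
    also have "\<bar>?A i j * (x * (?C (h j) - F (d j)))\<bar> \<le> ?A i j * (\<eta> + of_bool (h j \<noteq> d j))"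
    proof -
      have "\<bar>?C (h j) - F (d j)\<bar> \<le> \<eta> + of_bool (h j \<noteq> d j)"
        using \<eta>[of "h j"] F(2)[of "h j"] F(3)[of "h j"] F(2)[of "d j"] F(3)[of "d j"]
        by (cases "h j = d j") auto
      then have "\<bar>x * (?C (h j) - F (d j))\<bar> \<le> 1 * (\<eta> + of_bool (h j \<noteq> d j))"
        unfolding abs_mult using xy by (intro mult_mono) auto
      then show ?thesis
        unfolding abs_mult[of "?A i j"] abs_of_nat mult_1 by (intro mult_left_mono) auto
    qed
    also have "\<bar>?A i j * ((x - y) * F (d j))\<bar> \<le> ?A i j * \<bar>x - y\<bar>"
      using F(2,3)[of "d j"] by (simp add: abs_mult mult_left_mono mult_left_le)
    also have "\<bar>(?G i j - ?A i j) * (y * F (d j))\<bar> \<le> ?G i j - ?A i j"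
      using AG xy F(2,3)[of "d j"] by (simp add: abs_mult mult_left_le mult_le_one)
    finally show ?thesis by (simp only: x_def y_def) linarith
  qed
  have s1: "(\<Sum>i=1..n. \<Sum>j=1..n. ?A i j * \<bar>of_bool (h i = k) - of_bool (d i = k)\<bar>) \<le> real k * E"
  proof -
    have "(\<Sum>i=1..n. \<Sum>j=1..n. ?A i j * \<bar>of_bool (h i = k) - of_bool (d i = k)\<bar>)
        = (\<Sum>i=1..n. real (h i) * \<bar>of_bool (h i = k) - of_bool (d i = k)\<bar>)"
      by (simp only: sum_distrib_right[symmetric] rowA)
    \<comment> \<open>Where the indicators differ, \<open>h i \<le> k\<close>: either
      \<open>h i = k\<close>, or \<open>h i \<le> d i = k\<close>.\<close>
    also have "\<dots> \<le> (\<Sum>i=1..n. real k * of_bool (h i \<noteq> d i))"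
    proof (intro sum_mono)
      fix i assume "i \<in> {1..n}"
      then show "real (h i) * \<bar>of_bool (h i = k) - of_bool (d i = k)\<bar> \<le> real k * of_bool (h i \<noteq> d i)"
        using hd[of i] by auto
    qed
    also have "\<dots> \<le> real k * E"
      unfolding sum_distrib_left[symmetric] by (intro mult_left_mono ch) simp
    finally show ?thesis .
  qed
  have s2: "(\<Sum>i=1..n. \<Sum>j=1..n. ?A i j * (\<eta> + of_bool (h j \<noteq> d j))) \<le> L * \<eta> + (real M * E + R)"
  proof -
    \<comment> \<open>The error belongs to the neighbour \<open>j\<close>; symmetry turns the sum
      over edges into one weighted by the degree of \<open>j\<close>.\<close>
    have "(\<Sum>i=1..n. \<Sum>j=1..n. ?A i j * (\<eta> + of_bool (h j \<noteq> d j)))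
        = (\<Sum>j=1..n. \<Sum>i=1..n. ?A j i * (\<eta> + of_bool (h j \<noteq> d j)))"
      by (subst sum.swap) (simp only: erased_adj_commute)
    also have "\<dots> = (\<Sum>j=1..n. real (h j) * (\<eta> + of_bool (h j \<noteq> d j)))"
      by (simp only: sum_distrib_right[symmetric] rowA)
    also have "\<dots> \<le> (\<Sum>j=1..n. real (d j) * (\<eta> + of_bool (h j \<noteq> d j)))"
      using hd \<eta>0 by (intro sum_mono mult_right_mono) auto
    also have "\<dots> = (\<Sum>j=1..n. real (d j)) * \<eta> + (\<Sum>j=1..n. real (d j) * of_bool (h j \<noteq> d j))"
      by (simp only: distrib_left sum.distrib sum_distrib_right)
    finally show ?thesis using chd unfolding L_def total_degree_def of_nat_sum by linarith
  qed
  have s3: "(\<Sum>i=1..n. \<Sum>j=1..n. ?G i j - ?A i j) = E"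
    using sum_erased_degree[OF P] by (simp only: E_def L_def h_def)
  have "\<bar>(\<Sum>i=1..n. \<Sum>j=1..n. ?A i j * of_bool (h i = k) * ?C (h j))
      - (\<Sum>i=1..n. \<Sum>j=1..n. ?G i j * of_bool (d i = k) * F (d j))\<bar>
      = \<bar>\<Sum>i=1..n. \<Sum>j=1..n. ?A i j * of_bool (h i = k) * ?C (h j) - ?G i j * of_bool (d i = k) * F (d j)\<bar>"
    by (simp only: sum_subtractf)
  also have "\<dots> \<le> (\<Sum>i=1..n. \<Sum>j=1..n. \<bar>?A i j * of_bool (h i = k) * ?C (h j) - ?G i j * of_bool (d i = k) * F (d j)\<bar>)"
    by (rule order_trans[OF sum_abs sum_mono]) (rule sum_abs)
  also have "\<dots> \<le> (\<Sum>i=1..n. \<Sum>j=1..n. ?A i j * \<bar>of_bool (h i = k) - of_bool (d i = k)\<bar>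
      + ?A i j * (\<eta> + of_bool (h j \<noteq> d j)) + (?G i j - ?A i j))"
    by (intro sum_mono pt)
  also have "\<dots> \<le> real k * E + (L * \<eta> + (real M * E + R)) + E"
    using s1 s2 s3 unfolding sum.distrib by linarith
  finally have "\<bar>(\<Sum>i=1..n. \<Sum>j=1..n. ?A i j * of_bool (h i = k) * ?C (h j)) / L
      - (\<Sum>i=1..n. \<Sum>j=1..n. ?G i j * of_bool (d i = k) * F (d j)) / L\<bar>
      \<le> (real k * E + (L * \<eta> + (real M * E + R)) + E) / L"
    using L0 unfolding diff_divide_distrib[symmetric] abs_divide by (simp only: abs_of_pos divide_right_mono less_imp_le)
  also have "\<dots> = (real k + 2 * real M + 2) * (E / L) + 3 * (R / L)
      + (\<Sum>m\<le>M. \<bar>empirical_sb_cdf n d m - F m\<bar>) + (1 - F M)"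
    using L0 by (simp add: \<eta>_def add_divide_distrib distrib_right distrib_left)
  finally show ?thesis .
qed

lemma erased_count_close:
  assumes P: "P \<in> pairings (stubs n d)"
  defines "h \<equiv> erased_degree n P"
  shows "\<bar>(\<Sum>i=1..n. of_bool (h i = k)) - (\<Sum>i=1..n. of_bool (d i = k))\<bar>
    \<le> real (total_degree n d) - real (total_degree n h)"
proof -
  have "\<bar>(\<Sum>i=1..n. of_bool (h i = k)) - (\<Sum>i=1..n. of_bool (d i = k) :: real)\<bar>
      \<le> (\<Sum>i=1..n. \<bar>of_bool (h i = k) - of_bool (d i = k) :: real\<bar>)"
    unfolding sum_subtractf[symmetric] by (rule sum_abs)
  also have "\<dots> \<le> (\<Sum>i=1..n. of_bool (h i \<noteq> d i))"
    by (intro sum_mono) auto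
  also have "\<dots> \<le> real (total_degree n d) - real (total_degree n h)"
    using erased_degree_le[OF P] unfolding h_def by (rule sum_changed_le)
  finally show ?thesis .
qed

section \<open>Size-biased averages of independent degrees\<close>

lemma expectation_Pi_pmf_component:
  fixes u :: "'b \<Rightarrow> real"
  assumes "finite I" and "i \<in> I"
  shows "measure_pmf.expectation (Pi_pmf I dflt (\<lambda>_. p)) (\<lambda>d. u (d i)) = measure_pmf.expectation p u"
    and "integrable (measure_pmf (Pi_pmf I dflt (\<lambda>_. p))) (\<lambda>d. u (d i)) \<longleftrightarrow> integrable (measure_pmf p) u"
proof -
  have eq: "map_pmf (\<lambda>d. d i) (Pi_pmf I dflt (\<lambda>_. p)) = p"
    using assms by (simp add: Pi_pmf_component)
  show "measure_pmf.expectation (Pi_pmf I dflt (\<lambda>_. p)) (\<lambda>d. u (d i)) = measure_pmf.expectation p u"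
    by (subst eq[symmetric]) simp
  show "integrable (measure_pmf (Pi_pmf I dflt (\<lambda>_. p))) (\<lambda>d. u (d i)) \<longleftrightarrow> integrable (measure_pmf p) u"
    by (subst (2) eq[symmetric]) simp
qed

lemma expectation_Pi_pmf_mult:
  fixes u :: "'b \<Rightarrow> real"
  assumes "finite I" and "i \<in> I" "j \<in> I" "i \<noteq> j" and u: "integrable (measure_pmf p) u"
  shows "measure_pmf.expectation (Pi_pmf I dflt (\<lambda>_. p)) (\<lambda>d. u (d i) * u (d j))
      = (measure_pmf.expectation p u)\<^sup>2"
proof -
  let ?M = "measure_pmf (Pi_pmf I dflt (\<lambda>_. p))"
  note P = measure_pmf.prob_space_axioms
  have "prob_space.indep_vars ?M (\<lambda>_. borel) (\<lambda>x d. u (d x)) I"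
    by (rule prob_space.indep_vars_compose2[OF P indep_vars_Pi_pmf[OF assms(1)]]) auto
  then have ind: "prob_space.indep_vars ?M (\<lambda>_. borel) (\<lambda>x d. u (d x)) {i, j}"
    by (rule prob_space.indep_vars_subset[OF P]) (use assms in auto)
  have "(\<integral>d. (\<Prod>x\<in>{i, j}. u (d x)) \<partial>?M) = (\<Prod>x\<in>{i, j}. \<integral>d. u (d x) \<partial>?M)"
    by (rule prob_space.indep_vars_lebesgue_integral[OF P _ ind])
      (use assms in \<open>auto simp: expectation_Pi_pmf_component\<close>)
  then show ?thesis
    using assms by (simp add: expectation_Pi_pmf_component power2_eq_square)
qed

text \<open>Independence removes the off-diagonal terms of the centred square, and the centred
  variable is bounded by \<open>2 * B\<close>, hence the constant 4.\<close>

lemma expectation_average_bounded_le: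
  fixes u :: "nat \<Rightarrow> real"
  assumes "0 < n" and B: "\<And>x. \<bar>u x\<bar> \<le> B"
  shows "measure_pmf.expectation (Pi_pmf {1..n} 0 (\<lambda>_. p))
      (\<lambda>d. \<bar>(\<Sum>i=1..n. u (d i)) / real n - measure_pmf.expectation p u\<bar>) \<le> sqrt (4 * B\<^sup>2 / real n)"
proof -
  define m where "m = measure_pmf.expectation p u"
  define v where "v = (\<lambda>x. u x - m)"
  let ?M = "measure_pmf (Pi_pmf {1..n} 0 (\<lambda>_. p))"
  have intu: "integrable (measure_pmf p) u"
    using B by (intro measure_pmf.integrable_const_bound[where B = B]) auto
  have "\<bar>m\<bar> \<le> measure_pmf.expectation p (\<lambda>x. \<bar>u x\<bar>)"
    unfolding m_def using integral_norm_bound[of "measure_pmf p" u] by simp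
  also have "\<dots> \<le> measure_pmf.expectation p (\<lambda>_. B)"
    using intu B by (intro integral_mono) auto
  finally have m: "\<bar>m\<bar> \<le> B" by simp
  have v: "\<bar>v x\<bar> \<le> 2 * B" for x
    using B[of x] m unfolding v_def by linarith
  have v0: "measure_pmf.expectation p v = 0"
    using intu by (simp add: v_def m_def)
  have intv: "integrable (measure_pmf p) v"
    using intu by (simp add: v_def)
  have int: "integrable ?M f" if "\<And>d. \<bar>f d\<bar> \<le> C" for f :: "_ \<Rightarrow> real" and C
    using that by (intro measure_pmf.integrable_const_bound[where B = C]) auto
  have vv: "\<bar>v x * v y\<bar> \<le> 4 * B\<^sup>2" for x y
    using mult_mono[OF v[of x] v[of y]] v[of x] by (simp add: abs_mult power2_eq_square)
  have intvv: "integrable ?M (\<lambda>d. v (d i) * v (d j))" for i j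
    using vv by (rule int)
  have avg: "(\<Sum>i=1..n. u (d i)) / real n - m = (\<Sum>i=1..n. v (d i)) / real n" for d
    using assms(1) by (simp add: v_def sum_subtractf field_simps)
  have "\<bar>\<Sum>i=1..n. v (d i)\<bar> \<le> n * (2 * B)" for d
  proof -
    have "\<bar>\<Sum>i=1..n. v (d i)\<bar> \<le> (\<Sum>i=1..n. \<bar>v (d i)\<bar>)" by (rule sum_abs)
    also have "\<dots> \<le> (\<Sum>i=1..n. 2 * B)" by (intro sum_mono v)
    finally show ?thesis by simp
  qed
  then have intX: "integrable ?M (\<lambda>d. \<Sum>i=1..n. v (d i))"
    by (rule int)
  have sq: "((\<Sum>i=1..n. v (d i)) / real n)\<^sup>2 = (\<Sum>i=1..n. \<Sum>j=1..n. v (d i) * v (d j)) / (real n)\<^sup>2" for d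
    by (simp add: power_divide power2_eq_square sum_product)
  have intX2: "integrable ?M (\<lambda>d. ((\<Sum>i=1..n. v (d i)) / real n)\<^sup>2)"
    unfolding sq using intvv by simp
  have "measure_pmf.expectation (Pi_pmf {1..n} 0 (\<lambda>_. p)) (\<lambda>d. ((\<Sum>i=1..n. v (d i)) / real n)\<^sup>2)
    = (\<Sum>i=1..n. \<Sum>j=1..n. \<integral>d. v (d i) * v (d j) \<partial>?M) / (real n)\<^sup>2"
    unfolding sq using intvv by (simp add: Bochner_Integration.integral_sum)
  also have "\<dots> \<le> (\<Sum>i=1..n. \<Sum>j=1..n. if i = j then 4 * B\<^sup>2 else 0) / (real n)\<^sup>2"
  proof (intro divide_right_mono sum_mono)
    fix i j assume ij: "i \<in> {1..n}" "j \<in> {1..n}"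
    show "(\<integral>d. v (d i) * v (d j) \<partial>?M) \<le> (if i = j then 4 * B\<^sup>2 else 0)"
    proof (cases "i = j")
      case True
      have "(\<integral>d. v (d i) * v (d j) \<partial>?M) \<le> (\<integral>d. 4 * B\<^sup>2 \<partial>?M)"
        using vv by (intro integral_mono intvv) (auto simp: abs_le_iff)
      then show ?thesis using True by simp
    next
      case False
      then show ?thesis
        using expectation_Pi_pmf_mult[OF finite_atLeastAtMost ij False intv] v0 by simp
    qed
  qed simp
  also have "\<dots> = 4 * B\<^sup>2 / real n"
    using assms(1) by (simp add: power2_eq_square)
  finally show ?thesis
    unfolding m_def[symmetric] avg
    by (intro measure_pmf.expectation_abs_le_sqrt)
      (use intX intX2 in auto)
qed

text \<open>With only a first moment, \<open>u\<close> is truncated to arguments up to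
  \<open>K\<close>. The bounded part is handled by second moments; the remainder costs its mean
  \<open>r K\<close> twice, once in the average and once in the expectation, and vanishes by
  dominated convergence.\<close>

lemma weak_law_of_large_numbers_L1:
  fixes u :: "nat \<Rightarrow> real"
  assumes u: "integrable (measure_pmf p) u"
  shows "(\<lambda>n. measure_pmf.expectation (Pi_pmf {1..n} 0 (\<lambda>_. p))
      (\<lambda>d. \<bar>(\<Sum>i=1..n. u (d i)) / real n - measure_pmf.expectation p u\<bar>)) \<longlonglongrightarrow> 0"
    (is "?E \<longlonglongrightarrow> 0")
proof -
  define t where "t = (\<lambda>K x. if x \<le> K then u x else 0)" for K :: nat
  define r where "r = (\<lambda>K. measure_pmf.expectation p (\<lambda>x. \<bar>u x - t K x\<bar>))"
  have intt: "integrable (measure_pmf p) (t K)" for K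
    by (rule Bochner_Integration.integrable_bound[OF u]) (auto simp: t_def)
  have lim: "r \<longlonglongrightarrow> measure_pmf.expectation p (\<lambda>x. 0)"
    unfolding r_def
  proof (rule integral_dominated_convergence[where w = "\<lambda>x. \<bar>u x\<bar>"])
    show "AE x in measure_pmf p. (\<lambda>K. \<bar>u x - t K x\<bar>) \<longlonglongrightarrow> 0"
    proof (rule AE_I2)
      fix x
      have "eventually (\<lambda>K. \<bar>u x - t K x\<bar> = 0) sequentially"
        using eventually_ge_at_top[of x] by eventually_elim (simp add: t_def)
      then show "(\<lambda>K. \<bar>u x - t K x\<bar>) \<longlonglongrightarrow> 0"
        by (rule tendsto_eventually)
    qed
  qed (use u in \<open>auto simp: t_def\<close>)
  have bound: "?E n \<le> sqrt (4 * (\<Sum>x\<le>K. \<bar>u x\<bar>)\<^sup>2 / real n) + 2 * r K" if n: "0 < n" for n K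
  proof -
    let ?M = "measure_pmf (Pi_pmf {1..n} 0 (\<lambda>_. p))"
    let ?avg = "\<lambda>f d. (\<Sum>i=1..n. f (d i)) / real n"
    have marg: "integrable ?M (\<lambda>d. f (d i))" "(\<integral>d. f (d i) \<partial>?M) = measure_pmf.expectation p f"
      if "integrable (measure_pmf p) f" "i \<in> {1..n}" for f :: "nat \<Rightarrow> real" and i
      using that by (simp_all add: expectation_Pi_pmf_component)
    have iavg: "integrable ?M (?avg f)" if "integrable (measure_pmf p) f" for f :: "nat \<Rightarrow> real"
      by (intro integrable_divide_zero Bochner_Integration.integrable_sum marg(1) that)
    have intr: "integrable (measure_pmf p) (\<lambda>x. \<bar>u x - t K x\<bar>)"
      using u intt by auto
    have Et: "\<bar>measure_pmf.expectation p (t K) - measure_pmf.expectation p u\<bar> \<le> r K"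
      using integral_abs_bound[of "measure_pmf p" "\<lambda>x. u x - t K x"] u intt[of K]
      by (simp add: r_def abs_minus_commute)
    have pt: "\<bar>?avg u d - measure_pmf.expectation p u\<bar>
      \<le> \<bar>?avg (t K) d - measure_pmf.expectation p (t K)\<bar> + ?avg (\<lambda>x. \<bar>u x - t K x\<bar>) d + r K" for d
    proof -
      have "\<bar>?avg u d - ?avg (t K) d\<bar> \<le> ?avg (\<lambda>x. \<bar>u x - t K x\<bar>) d"
        unfolding diff_divide_distrib[symmetric] sum_subtractf[symmetric] abs_divide abs_of_nat
        by (intro divide_right_mono) (auto simp: sum_abs)
      then show ?thesis using Et by linarith
    qed
    have "?E n \<le> (\<integral>d. \<bar>?avg (t K) d - measure_pmf.expectation p (t K)\<bar> + ?avg (\<lambda>x. \<bar>u x - t K x\<bar>) d + r K \<partial>?M)"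
      using pt iavg[OF u] iavg[OF intt[of K]] iavg[OF intr]
      by (intro integral_mono) auto
    also have "\<dots> = (\<integral>d. \<bar>?avg (t K) d - measure_pmf.expectation p (t K)\<bar> \<partial>?M)
        + (\<integral>d. ?avg (\<lambda>x. \<bar>u x - t K x\<bar>) d \<partial>?M) + r K"
      using iavg[OF intt[of K]] iavg[OF intr] by (simp add: Bochner_Integration.integral_add)
    also have "(\<integral>d. ?avg (\<lambda>x. \<bar>u x - t K x\<bar>) d \<partial>?M) = r K"
    proof -
      have "(\<integral>d. ?avg (\<lambda>x. \<bar>u x - t K x\<bar>) d \<partial>?M) = (\<Sum>i=1..n. \<integral>d. \<bar>u (d i) - t K (d i)\<bar> \<partial>?M) / real n"
        using marg(1)[OF intr] by (simp add: Bochner_Integration.integral_sum)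
      also have "\<dots> = (\<Sum>i=1..n. r K) / real n"
        using marg(2)[OF intr] by (simp add: r_def)
      finally show ?thesis using n by simp
    qed
    also have "(\<integral>d. \<bar>?avg (t K) d - measure_pmf.expectation p (t K)\<bar> \<partial>?M)
        \<le> sqrt (4 * (\<Sum>x\<le>K. \<bar>u x\<bar>)\<^sup>2 / real n)"
    proof (rule expectation_average_bounded_le[OF n])
      \<comment> \<open>The truncation acts on the argument, so finitely many values of
        \<open>u\<close> remain and the sum of their absolute values is a crude bound.\<close>
      show "\<bar>t K x\<bar> \<le> (\<Sum>x\<le>K. \<bar>u x\<bar>)" for x
        using member_le_sum[of x "{..K}" "\<lambda>x. \<bar>u x\<bar>"] by (auto simp: t_def sum_nonneg)
    qed
    finally show ?thesis by simp
  qed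
  show ?thesis
  proof (rule LIMSEQ_I)
    fix e :: real assume e: "0 < e"
    have "eventually (\<lambda>K. r K < e / 4) sequentially"
      using order_tendstoD(2)[OF lim, of "e / 4"] e by simp
    then obtain K where K: "r K < e / 4"
      by (auto simp: eventually_sequentially)
    have "(\<lambda>n. sqrt (4 * (\<Sum>x\<le>K. \<bar>u x\<bar>)\<^sup>2 / real n)) \<longlonglongrightarrow> sqrt 0"
      by (intro tendsto_real_sqrt real_tendsto_divide_at_top[OF tendsto_const] filterlim_real_sequentially)
    then have "eventually (\<lambda>n. sqrt (4 * (\<Sum>x\<le>K. \<bar>u x\<bar>)\<^sup>2 / real n) < e / 2) sequentially"
      using order_tendstoD(2)[of _ "sqrt 0" _ "e / 2"] e by simp
    then have "eventually (\<lambda>n. norm (?E n - 0) < e) sequentially"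
      using eventually_gt_at_top[of 0]
    proof eventually_elim
      case (elim n)
      have "0 \<le> ?E n" by (intro Bochner_Integration.integral_nonneg) auto
      then show ?case using bound[OF elim(2), of K] K elim(1) by simp
    qed
    then show "\<exists>n0. \<forall>n\<ge>n0. norm (?E n - 0) < e"
      by (simp add: eventually_sequentially)
  qed
qed

section \<open>Size-biased averages as quotients of sums\<close>

text \<open>The mean of \<open>\<psi>\<close> at the degree of a uniformly chosen stub. Indicators
  turn it into the empirical size-biased density, distribution function and tail.\<close>

definition sb_average :: "nat \<Rightarrow> (nat \<Rightarrow> nat) \<Rightarrow> (nat \<Rightarrow> real) \<Rightarrow> real" where
  "sb_average n d \<psi> = (\<Sum>i=1..n. real (d i) * \<psi> (d i)) / real (total_degree n d)"

lemma sb_average_bounds: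
  assumes "\<And>x. 0 \<le> \<psi> x" "\<And>x. \<psi> x \<le> 1"
  shows "0 \<le> sb_average n d \<psi>" and "sb_average n d \<psi> \<le> 1"
proof -
  show "0 \<le> sb_average n d \<psi>"
    using assms by (auto simp: sb_average_def intro!: divide_nonneg_nonneg sum_nonneg)
  have "(\<Sum>i=1..n. real (d i) * \<psi> (d i)) \<le> (\<Sum>i=1..n. real (d i))"
    using assms by (intro sum_mono mult_left_le) auto
  moreover have "0 \<le> (\<Sum>i=1..n. real (d i))" by (simp add: sum_nonneg)
  ultimately show "sb_average n d \<psi> \<le> 1"
    unfolding sb_average_def total_degree_def of_nat_sum divide_le_eq_1 by linarith
qed

lemma expectation_pos:
  assumes "integrable (measure_pmf D) real" and "0 \<notin> set_pmf D"
  shows "1 \<le> measure_pmf.expectation D real"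
proof -
  have "measure_pmf.expectation D (\<lambda>_. 1) \<le> measure_pmf.expectation D real"
    using assms by (intro integral_mono_AE AE_pmfI) (auto simp: Suc_le_eq intro: gr0I)
  then show ?thesis by simp
qed

lemma expectation_size_biased:
  fixes \<psi> :: "nat \<Rightarrow> real"
  assumes "integrable (measure_pmf D) real" and "0 \<notin> set_pmf D"
  shows "measure_pmf.expectation (size_biased_pmf D) \<psi>
    = measure_pmf.expectation D (\<lambda>x. real x * \<psi> x) / measure_pmf.expectation D real"
proof -
  let ?m = "measure_pmf.expectation D real"
  have pos: "0 < ?m" using expectation_pos[OF assms] by linarith
  have "measure_pmf.expectation (size_biased_pmf D) \<psi>
      = (\<integral>x. size_biased_density D x * \<psi> x \<partial>count_space UNIV)"
    unfolding measure_pmf_eq_density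
    using pos by (subst integral_density) (auto simp: pmf_size_biased[OF assms(1) pos] size_biased_density_def)
  also have "\<dots> = (\<integral>x. pmf D x * (real x * \<psi> x / ?m) \<partial>count_space UNIV)"
    by (intro Bochner_Integration.integral_cong) (simp_all add: size_biased_density_def)
  also have "\<dots> = measure_pmf.expectation D (\<lambda>x. real x * \<psi> x / ?m)"
    unfolding measure_pmf_eq_density by (subst integral_density) auto
  finally show ?thesis by simp
qed

text \<open>With denominators at least 1 and \<open>a / b \<le> 1\<close> the quotient obeys a
  Lipschitz bound, so convergence in mean passes from numerator and denominator to the quotient.
  Degrees of at least 1 supply the bounds on the denominators.\<close>

lemma abs_quotient_diff_le:
  fixes a b x y :: real
  assumes "1 \<le> y" "1 \<le> b" "0 \<le> a" "a \<le> b"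
  shows "\<bar>x / y - a / b\<bar> \<le> \<bar>x - a\<bar> + \<bar>y - b\<bar>"
proof -
  have "x / y - a / b = (x - a) / y + (a / b) * ((b - y) / y)"
    using assms by (simp add: field_simps)
  then have "\<bar>x / y - a / b\<bar> \<le> \<bar>(x - a) / y\<bar> + \<bar>(a / b) * ((b - y) / y)\<bar>"
    using abs_triangle_ineq by metis
  moreover have "\<bar>(x - a) / y\<bar> \<le> \<bar>x - a\<bar>"
    using assms by (simp add: abs_divide divide_le_eq mult_le_cancel_left1)
  moreover have "\<bar>(a / b) * ((b - y) / y)\<bar> \<le> 1 * \<bar>y - b\<bar>"
    unfolding abs_mult using assms
    by (intro mult_mono) (simp_all add: abs_divide divide_le_eq mult_le_cancel_left1 abs_minus_commute)
  ultimately show ?thesis by linarith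
qed

lemma sb_average_tendsto:
  fixes \<psi> :: "nat \<Rightarrow> real"
  assumes int: "integrable (measure_pmf D) real" and D0: "0 \<notin> set_pmf D"
    and \<psi>: "\<And>x. 0 \<le> \<psi> x" "\<And>x. \<psi> x \<le> 1"
  shows "(\<lambda>n. measure_pmf.expectation (iid_degrees D n)
      (\<lambda>d. \<bar>sb_average n d \<psi> - measure_pmf.expectation (size_biased_pmf D) \<psi>\<bar>)) \<longlonglongrightarrow> 0"
    (is "?E \<longlonglongrightarrow> 0")
proof -
  define u where "u = (\<lambda>x. real x * \<psi> x)"
  define a where "a = measure_pmf.expectation D u"
  define b where "b = measure_pmf.expectation D real"
  let ?P = "\<lambda>n. Pi_pmf {1..n} 0 (\<lambda>_. D)"
  define A where "A = (\<lambda>n. measure_pmf.expectation (?P n) (\<lambda>d. \<bar>(\<Sum>i=1..n. u (d i)) / real n - a\<bar>))"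
  define B where "B = (\<lambda>n. measure_pmf.expectation (?P n) (\<lambda>d. \<bar>(\<Sum>i=1..n. real (d i)) / real n - b\<bar>))"
  have u: "0 \<le> u x" "u x \<le> real x" for x
    using \<psi>[of x] by (auto simp: u_def mult_left_le)
  have intu: "integrable (measure_pmf D) u"
    by (rule Bochner_Integration.integrable_bound[OF int]) (use u in auto)
  have b1: "1 \<le> b" unfolding b_def by (rule expectation_pos[OF int D0])
  have ab: "0 \<le> a" "a \<le> b"
    using u intu int by (auto simp: a_def b_def intro!: Bochner_Integration.integral_nonneg integral_mono)
  have bound: "?E n \<le> A n + B n + (b + 2) / real n" if n: "0 < n" for n
  proof -
    let ?M = "measure_pmf (?P n)"
    have marg: "integrable ?M (\<lambda>d. f (d i))" "(\<integral>d. f (d i) \<partial>?M) = measure_pmf.expectation D f"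
      if "integrable (measure_pmf D) f" "i \<in> {1..n}" for f :: "nat \<Rightarrow> real" and i
      using that by (simp_all add: expectation_Pi_pmf_component)
    have pt: "\<bar>sb_average n (fix_parity n d) \<psi> - a / b\<bar>
        \<le> \<bar>(\<Sum>i=1..n. u (d i)) / real n - a\<bar> + \<bar>(\<Sum>i=1..n. real (d i)) / real n - b\<bar>
          + (real (d n) + 2) / real n"
      if d: "d \<in> set_pmf (?P n)" for d
    proof -
      define e where "e = fix_parity n d"
      have d1: "1 \<le> d i" if "i \<in> {1..n}" for i
      proof -
        have "d i \<in> set_pmf D" using d that by (auto simp: set_Pi_pmf PiE_dflt_def)
        then have "d i \<noteq> 0" using D0 by metis
        then show ?thesis by simp
      qed
      have e: "e i = d i" if "i \<noteq> n" for i using that by (simp add: e_def fix_parity_def)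
      have en: "d n \<le> e n" "e n \<le> d n + 1" by (auto simp: e_def fix_parity_def)
      have split: "(\<Sum>i=1..n. f (e i)) = (\<Sum>i=1..n. f (d i)) + (f (e n) - f (d n))" for f :: "nat \<Rightarrow> real"
      proof -
        have "(\<Sum>i=1..n. f (e i) - f (d i)) = (\<Sum>i\<in>{n}. f (e i) - f (d i))"
          using n e by (intro sum.mono_neutral_right) auto
        then show ?thesis by (simp add: sum_subtractf)
      qed
      have "(\<Sum>i=1..n. (1::real)) \<le> (\<Sum>i=1..n. real (e i))"
      proof (intro sum_mono)
        fix i assume "i \<in> {1..n}"
        then have "1 \<le> e i" using d1[of i] e[of i] en(1) by (cases "i = n") auto
        then show "1 \<le> real (e i)" by simp
      qed
      then have y: "1 \<le> (\<Sum>i=1..n. real (e i)) / real n"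
        using n by simp
      have "sb_average n e \<psi> = ((\<Sum>i=1..n. u (e i)) / real n) / ((\<Sum>i=1..n. real (e i)) / real n)"
        using n by (simp add: sb_average_def u_def total_degree_def)
      then have "\<bar>sb_average n e \<psi> - a / b\<bar>
          \<le> \<bar>(\<Sum>i=1..n. u (e i)) / real n - a\<bar> + \<bar>(\<Sum>i=1..n. real (e i)) / real n - b\<bar>"
        by (simp only: abs_quotient_diff_le[OF y b1 ab])
      \<comment> \<open>The parity correction. As \<open>\<psi>\<close> need not be continuous in
        any sense, one extra stub may move \<open>u\<close> by as much as \<open>d n + 1\<close>;
        this is unbounded, but its mean is \<open>b + 1\<close> and it is divided by
        \<open>n\<close>.\<close>
      also have "\<bar>(\<Sum>i=1..n. u (e i)) / real n - a\<bar>
          \<le> \<bar>(\<Sum>i=1..n. u (d i)) / real n - a\<bar> + (real (d n) + 1) / real n"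
      proof -
        have "\<bar>u (e n) - u (d n)\<bar> \<le> real (d n) + 1"
          using u(1)[of "e n"] u(1)[of "d n"] u(2)[of "e n"] u(2)[of "d n"] en by linarith
        then have "\<bar>(u (e n) - u (d n)) / real n\<bar> \<le> (real (d n) + 1) / real n"
          using n by (simp add: abs_divide divide_right_mono)
        then show ?thesis unfolding split[of u] add_divide_distrib by linarith
      qed
      also have "\<bar>(\<Sum>i=1..n. real (e i)) / real n - b\<bar>
          \<le> \<bar>(\<Sum>i=1..n. real (d i)) / real n - b\<bar> + 1 / real n"
      proof -
        have "\<bar>(real (e n) - real (d n)) / real n\<bar> \<le> 1 / real n"
          using n en by (simp add: abs_divide divide_right_mono)
        then show ?thesis unfolding split[of real] add_divide_distrib by linarith
      qed
      finally show ?thesis by (simp add: e_def add_divide_distrib)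
    qed
    have i1: "integrable ?M (\<lambda>d. (\<Sum>i=1..n. u (d i)) / real n)"
      by (intro integrable_divide_zero Bochner_Integration.integrable_sum marg(1) intu)
    have i2: "integrable ?M (\<lambda>d. (\<Sum>i=1..n. real (d i)) / real n)"
      by (intro integrable_divide_zero Bochner_Integration.integrable_sum marg(1) int)
    have i3: "integrable ?M (\<lambda>d. real (d n))" "(\<integral>d. real (d n) \<partial>?M) = b"
      using marg[OF int, of n] n by (auto simp: b_def)
    have "?E n = (\<integral>d. \<bar>sb_average n (fix_parity n d) \<psi> - a / b\<bar> \<partial>?M)"
      by (simp add: iid_degrees_def expectation_size_biased[OF int D0] a_def b_def u_def)
    also have "\<dots> \<le> (\<integral>d. \<bar>(\<Sum>i=1..n. u (d i)) / real n - a\<bar> + \<bar>(\<Sum>i=1..n. real (d i)) / real n - b\<bar>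
          + (real (d n) + 2) / real n \<partial>?M)"
    proof (intro integral_mono_AE AE_pmfI pt)
      have "\<bar>sb_average n d \<psi> - a / b\<bar> \<le> 1 + \<bar>a / b\<bar>" for d
        using sb_average_bounds[where \<psi> = \<psi> and n = n and d = d, OF \<psi>] by linarith
      then show "integrable ?M (\<lambda>d. \<bar>sb_average n (fix_parity n d) \<psi> - a / b\<bar>)"
        by (intro measure_pmf.integrable_const_bound[where B = "1 + \<bar>a / b\<bar>"]) auto
    qed (use i1 i2 i3 in auto)
    also have "\<dots> = A n + B n + (b + 2) / real n"
      using i1 i2 i3 by (simp add: A_def B_def Bochner_Integration.integral_add)
    finally show ?thesis .
  qed
  have "A \<longlonglongrightarrow> 0" "B \<longlonglongrightarrow> 0"
    using weak_law_of_large_numbers_L1[OF intu] weak_law_of_large_numbers_L1[OF int]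
    by (simp_all add: A_def B_def a_def b_def)
  moreover have "(\<lambda>n. (b + 2) / real n) \<longlonglongrightarrow> 0"
    by (intro real_tendsto_divide_at_top[OF tendsto_const] filterlim_real_sequentially)
  ultimately have lim: "(\<lambda>n. A n + B n + (b + 2) / real n) \<longlonglongrightarrow> 0"
    using tendsto_add[OF tendsto_add] by fastforce
  show ?thesis
  proof (rule tendsto_sandwich[OF _ _ tendsto_const lim])
    show "\<forall>\<^sub>F n in sequentially. ?E n \<le> A n + B n + (b + 2) / real n"
      using eventually_gt_at_top[of 0] by eventually_elim (rule bound)
  qed (intro always_eventually allI Bochner_Integration.integral_nonneg, simp)
qed

section \<open>Convergence of the rank\<close>

lemma set_pmf_iid_degrees:
  assumes "0 \<notin> set_pmf D" and d: "d \<in> set_pmf (iid_degrees D n)"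
  shows "even (total_degree n d)" and "n \<le> total_degree n d"
proof -
  obtain d' where d': "d' \<in> set_pmf (Pi_pmf {1..n} 0 (\<lambda>_. D))" "d = fix_parity n d'"
    using d by (auto simp: iid_degrees_def)
  show "even (total_degree n d)"
    unfolding d'(2) by (rule even_total_degree_fix_parity)
  have "1 \<le> d i" if "i \<in> {1..n}" for i
  proof -
    have "d' i \<in> set_pmf D" using d'(1) that by (auto simp: set_Pi_pmf PiE_dflt_def)
    then have "d' i \<noteq> 0" using assms(1) by metis
    then show ?thesis by (auto simp: d'(2) fix_parity_def)
  qed
  then have "(\<Sum>i=1..n. 1) \<le> (\<Sum>i=1..n. d i)"
    by (intro sum_mono)
  then show "n \<le> total_degree n d"
    by (simp add: total_degree_def)
qed

lemma size_biased_cdf_eq_measure: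
  assumes "integrable (measure_pmf D) real" and "0 \<notin> set_pmf D"
  shows "size_biased_cdf D m = measure (measure_pmf (size_biased_pmf D)) {..m}"
proof -
  have "0 < measure_pmf.expectation D real" using expectation_pos[OF assms] by linarith
  then show ?thesis
    by (simp add: size_biased_cdf_def measure_measure_pmf_finite pmf_size_biased[OF assms(1)])
qed

lemma
  assumes "integrable (measure_pmf D) real" and "0 \<notin> set_pmf D"
  shows mono_size_biased_cdf: "mono (size_biased_cdf D)"
    and size_biased_cdf_nonneg: "0 \<le> size_biased_cdf D m"
    and size_biased_cdf_le_1: "size_biased_cdf D m \<le> 1"
    and size_biased_cdf_tendsto: "size_biased_cdf D \<longlonglongrightarrow> 1"
    and expectation_size_biased_le: "measure_pmf.expectation (size_biased_pmf D) (\<lambda>x. of_bool (x \<le> m)) = size_biased_cdf D m"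
    and expectation_size_biased_gt: "measure_pmf.expectation (size_biased_pmf D) (\<lambda>x. of_bool (m < x)) = 1 - size_biased_cdf D m"
    and expectation_size_biased_eq: "measure_pmf.expectation (size_biased_pmf D) (\<lambda>x. of_bool (x = m)) = size_biased_density D m"
proof -
  let ?S = "size_biased_pmf D"
  note F = size_biased_cdf_eq_measure[OF assms]
  have pos: "0 < measure_pmf.expectation D real" using expectation_pos[OF assms] by linarith
  show "mono (size_biased_cdf D)"
    unfolding F by (intro monoI measure_pmf.finite_measure_mono) auto
  show "0 \<le> size_biased_cdf D m" "size_biased_cdf D m \<le> 1"
    unfolding F by simp_all
  have "(\<lambda>m. measure (measure_pmf ?S) {..m}) \<longlonglongrightarrow> measure (measure_pmf ?S) (\<Union>m. {..m})"
    by (rule measure_pmf.finite_Lim_measure_incseq) (auto simp: incseq_def)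
  moreover have "(\<Union>m::nat. {..m}) = UNIV" by auto
  moreover have "measure (measure_pmf ?S) UNIV = 1"
    using measure_pmf.prob_space[of ?S] by simp
  ultimately show "size_biased_cdf D \<longlonglongrightarrow> 1"
    unfolding F[abs_def] by metis
  have ind: "measure_pmf.expectation ?S (\<lambda>x. of_bool (x \<in> A)) = measure (measure_pmf ?S) A" for A
  proof -
    have "(\<lambda>x. of_bool (x \<in> A) :: real) = indicator A" by (auto simp: indicator_def)
    then show ?thesis by simp
  qed
  show "measure_pmf.expectation ?S (\<lambda>x. of_bool (x \<le> m)) = size_biased_cdf D m"
    using ind[of "{..m}"] by (simp add: F)
  show "measure_pmf.expectation ?S (\<lambda>x. of_bool (m < x)) = 1 - size_biased_cdf D m"
  proof -
    have "- {..m} = {m<..}" by auto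
    then show ?thesis
      using ind[of "{m<..}"] measure_pmf.prob_compl[of "{..m}" ?S] by (simp add: F Compl_eq_Diff_UNIV)
  qed
  show "measure_pmf.expectation ?S (\<lambda>x. of_bool (x = m)) = size_biased_density D m"
    using ind[of "{m}"] by (simp add: measure_pmf_single pmf_size_biased[OF assms(1) pos])
qed

text \<open>The numerator of the rank in the unerased graph, with \<open>F\<close> in place of the empirical
  distribution function.\<close>

definition rank_sum :: "nat \<Rightarrow> nat \<Rightarrow> (nat \<Rightarrow> real) \<Rightarrow> (nat \<Rightarrow> nat) \<Rightarrow> (nat \<times> nat) set set \<Rightarrow> real" where
  "rank_sum n k F d P = (\<Sum>i=1..n. \<Sum>j=1..n. real (stub_adj d P i j) * of_bool (d i = k) * F (d j))"

text \<open>Errors determined by the degrees alone, controlled by the law of large numbers. The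
  values meant for \<open>p\<close> and \<open>c\<close> are the limits of the two averages: the
  size-biased density at \<open>k\<close> and the mean of \<open>F\<close>.\<close>

definition degree_error :: "nat \<Rightarrow> nat \<Rightarrow> nat \<Rightarrow> (nat \<Rightarrow> real) \<Rightarrow> real \<Rightarrow> real \<Rightarrow> (nat \<Rightarrow> nat) \<Rightarrow> real" where
  "degree_error n M k F p c d =
     \<bar>sb_average n d (\<lambda>x. of_bool (x = k)) - p\<bar> + \<bar>sb_average n d F - c\<bar>
     + 3 * sb_average n d (\<lambda>x. of_bool (M < x))
     + (\<Sum>m\<le>M. \<bar>sb_average n d (\<lambda>x. of_bool (x \<le> m)) - F m\<bar>) + (1 - F M)"

text \<open>Errors that depend on the pairing, to be averaged with the degrees fixed. The absolute
  value around the erased count makes the error nonnegative for every \<open>P\<close>, as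
  integration over the compound law demands.\<close>

definition pairing_error :: "nat \<Rightarrow> nat \<Rightarrow> nat \<Rightarrow> (nat \<Rightarrow> real) \<Rightarrow> (nat \<Rightarrow> nat) \<Rightarrow> (nat \<times> nat) set set \<Rightarrow> real" where
  "pairing_error n M k F d P =
     \<bar>rank_sum n k F d P / real (total_degree n d)
       - sb_average n d (\<lambda>x. of_bool (x = k)) * sb_average n d F\<bar>
     + (real k + 2 * real M + 2)
       * (\<bar>real (total_degree n d) - real (total_degree n (erased_degree n P))\<bar> / real (total_degree n d))"

text \<open>The deterministic core. The rank is a quotient \<open>s / q\<close> with
  \<open>s\<close> near \<open>p * c\<close> and \<open>q\<close> near \<open>p\<close>, both up to
  \<open>Z\<close>. As \<open>Z < p / 2\<close> forces \<open>q \<ge> p / 2\<close>, the total error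
  is at most \<open>2 * Z / (p / 2)\<close>.\<close>

lemma erased_annr_close:
  fixes M k :: nat and F :: "nat \<Rightarrow> real" and p c :: real
  assumes P: "P \<in> pairings (stubs n d)" and L: "0 < total_degree n d" and k: "0 < k"
    and F: "mono F" "\<And>x. 0 \<le> F x" "\<And>x. F x \<le> 1"
    and p: "0 < p" "p \<le> 1" and c: "0 \<le> c" "c \<le> 1"
  defines "Z \<equiv> pairing_error n M k F d P + degree_error n M k F p c d"
  assumes Z: "Z < p / 2"
  shows "\<bar>erased_annr n P k - c\<bar> \<le> 4 * Z / p"
proof -
  define h where "h = erased_degree n P"
  define l where "l = real (total_degree n d)"
  define E where "E = l - real (total_degree n h)"
  define s where "s = (\<Sum>i=1..n. \<Sum>j=1..n. real (erased_adj P i j) * of_bool (h i = k) * empirical_sb_cdf n h (h j)) / l"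
  define t where "t = rank_sum n k F d P / l"
  define N where "N = (\<Sum>i=1..n. of_bool (h i = k) :: real)"
  define a where "a = sb_average n d (\<lambda>x. of_bool (x = k))"
  define b where "b = sb_average n d F"
  have l: "0 < l" using L by (simp add: l_def)
  have "0 \<le> (\<Sum>i=1..n. of_bool (h i \<noteq> d i) :: real)" by (intro sum_nonneg) simp
  also have "\<dots> \<le> E"
    unfolding E_def l_def by (rule sum_changed_le) (use erased_degree_le[OF P] h_def in auto)
  finally have E: "0 \<le> E / l" using l by simp
  have ab: "0 \<le> a" "a \<le> 1" "0 \<le> b" "b \<le> 1"
    unfolding a_def b_def using F(2,3) by (auto intro!: sb_average_bounds)
  have tail: "0 \<le> sb_average n d (\<lambda>x. of_bool (M < x))"
    by (rule sb_average_bounds) auto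
  have sums: "0 \<le> (\<Sum>m\<le>M. \<bar>sb_average n d (\<lambda>x. of_bool (x \<le> m)) - F m\<bar>)"
    by (simp add: sum_nonneg)
  have Zeq: "Z = \<bar>t - a * b\<bar> + (real k + 2 * real M + 2) * (E / l) + \<bar>a - p\<bar> + \<bar>b - c\<bar>
     + 3 * sb_average n d (\<lambda>x. of_bool (M < x))
     + (\<Sum>m\<le>M. \<bar>sb_average n d (\<lambda>x. of_bool (x \<le> m)) - F m\<bar>) + (1 - F M)"
  proof -
    have "\<bar>E\<bar> / l = E / l" using E l by (simp add: zero_le_divide_iff)
    then show ?thesis
      unfolding Z_def pairing_error_def degree_error_def t_def a_def b_def E_def l_def h_def
      by (simp only: add.assoc)
  qed
  have "\<bar>s - t\<bar> \<le> (real k + 2 * real M + 2) * (E / l) + 3 * sb_average n d (\<lambda>x. of_bool (M < x))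
      + (\<Sum>m\<le>M. \<bar>sb_average n d (\<lambda>x. of_bool (x \<le> m)) - F m\<bar>) + (1 - F M)"
    using erased_neighbour_sum_close[OF P L F, where M = M and k = k]
    unfolding s_def t_def rank_sum_def h_def E_def l_def sb_average_def empirical_sb_cdf_def .
  moreover have "\<bar>a * b - p * c\<bar> \<le> \<bar>a - p\<bar> + \<bar>b - c\<bar>"
  proof -
    have "a * b - p * c = (a - p) * b + p * (b - c)" by (simp add: algebra_simps)
    also have "\<bar>\<dots>\<bar> \<le> \<bar>a - p\<bar> * \<bar>b\<bar> + \<bar>p\<bar> * \<bar>b - c\<bar>"
      unfolding abs_mult[symmetric] by (rule abs_triangle_ineq)
    also have "\<dots> \<le> \<bar>a - p\<bar> * 1 + 1 * \<bar>b - c\<bar>"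
      using ab p by (intro add_mono mult_left_mono mult_right_mono) auto
    finally show ?thesis by simp
  qed
  ultimately have sZ: "\<bar>s - p * c\<bar> \<le> Z"
    unfolding Zeq by linarith
  have NZ: "\<bar>real k * N / l - p\<bar> \<le> Z"
  proof -
    have a_eq: "a = real k * (\<Sum>i=1..n. of_bool (d i = k)) / l"
      unfolding a_def sb_average_def l_def sum_distrib_left
      by (intro arg_cong2[where f = "(/)"] sum.cong refl) auto
    have "real k * N / l - a = real k * ((N - (\<Sum>i=1..n. of_bool (d i = k))) / l)"
      unfolding a_eq by (simp only: right_diff_distrib diff_divide_distrib times_divide_eq_right)
    also have "\<bar>\<dots>\<bar> \<le> real k * (E / l)"
      unfolding abs_mult abs_of_nat abs_divide abs_of_pos[OF l]
      using erased_count_close[OF P, of k] l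
      by (intro mult_left_mono divide_right_mono) (simp_all only: N_def E_def h_def l_def of_nat_0_le_iff less_imp_le)
    finally have "\<bar>real k * N / l - a\<bar> \<le> real k * (E / l)" .
    moreover have "real k * (E / l) \<le> (real k + 2 * real M + 2) * (E / l)"
      using E by (intro mult_right_mono) auto
    ultimately show ?thesis
      unfolding Zeq using tail sums F(3)[of M] by linarith
  qed
  define q where "q = real k * N / l"
  \<comment> \<open>In particular some node has erased degree \<open>k\<close>, so the rank is not
    at its default value.\<close>
  have q: "p / 2 \<le> q" using NZ Z unfolding q_def by linarith
  have "erased_annr n P k = s / q"
    unfolding erased_annr_def s_def q_def N_def h_def
    by (subst annr_eq[OF _ erased_adj_commute k]) (use l in \<open>simp_all add: erased_degree_def\<close>)
  then have "erased_annr n P k - c = (s - p * c + c * (p - q)) / q"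
    using q p by (simp add: field_simps)
  then have "\<bar>erased_annr n P k - c\<bar> = \<bar>s - p * c + c * (p - q)\<bar> / q"
    using q p by (simp add: abs_divide)
  also have "\<dots> \<le> (2 * Z) / q"
  proof (rule divide_right_mono)
    have "\<bar>c * (p - q)\<bar> \<le> 1 * \<bar>p - q\<bar>"
      unfolding abs_mult using c by (intro mult_right_mono) auto
    also have "\<dots> \<le> Z"
      using NZ by (simp add: q_def abs_minus_commute)
    finally have "\<bar>s - p * c\<bar> + \<bar>c * (p - q)\<bar> \<le> Z + Z"
      by (rule add_mono[OF sZ])
    with abs_triangle_ineq[of "s - p * c" "c * (p - q)"]
    show "\<bar>s - p * c + c * (p - q)\<bar> \<le> 2 * Z"
      by linarith
  qed (use q p in auto)
  also have "\<dots> \<le> (2 * Z) / (p / 2)"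
    using q p sZ by (intro divide_left_mono mult_pos_pos) auto
  finally show ?thesis by simp
qed

section \<open>Expected errors and the passage to the limit\<close>

lemma expectation_rank_sum_close:
  assumes ev: "even (total_degree n d)" and L: "4 \<le> total_degree n d"
    and F: "\<And>x. 0 \<le> F x" "\<And>x. F x \<le> 1"
  shows "measure_pmf.expectation (pmf_of_set (pairings (stubs n d)))
      (\<lambda>P. \<bar>rank_sum n k F d P / real (total_degree n d)
        - sb_average n d (\<lambda>x. of_bool (x = k)) * sb_average n d F\<bar>)
    \<le> sqrt (20 / real (total_degree n d))"
proof -
  define g where "g = (\<lambda>s :: nat \<times> nat. of_bool (d (fst s) = k) :: real)"
  define f where "f = (\<lambda>s :: nat \<times> nat. F (d (fst s)))"
  have rank: "rank_sum n k F d P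
      = (\<Sum>x\<in>stubs n d \<times> stubs n d. g (fst x) * f (snd x) * of_bool ({fst x, snd x} \<in> P))" for P
    unfolding g_def f_def sum_stub_pairs[where w = "\<lambda>i j. of_bool (d i = k) * F (d j)"] rank_sum_def
    by (simp only: mult_ac)
  have avg: "(\<Sum>s\<in>stubs n d. \<psi> (d (fst s))) / real (total_degree n d) = sb_average n d \<psi>" for \<psi> :: "nat \<Rightarrow> real"
    by (simp add: sum_stubs sb_average_def)
  have avg_g: "(\<Sum>s\<in>stubs n d. g s) / real (total_degree n d) = sb_average n d (\<lambda>x. of_bool (x = k))"
    unfolding g_def by (rule avg)
  have avg_f: "(\<Sum>s\<in>stubs n d. f s) / real (total_degree n d) = sb_average n d F"
    unfolding f_def by (rule avg)
  have card: "even (card (stubs n d))" "4 \<le> card (stubs n d)"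
    using ev L by (simp_all only: card_stubs)
  have gf: "0 \<le> g s" "g s \<le> 1" "0 \<le> f s" "f s \<le> 1" for s
    using F by (simp_all add: g_def f_def)
  show ?thesis
    using expectation_edge_average[where g = g and h = f, OF finite_stubs card gf]
    unfolding rank card_stubs avg_g avg_f .
qed

text \<open>The level \<open>M'\<close> used to count erased stubs is free of \<open>M\<close>: the
  erased proportion must be small even against the factor that contains \<open>M\<close>.\<close>

lemma expectation_pairing_error_le:
  assumes ev: "even (total_degree n d)" and L: "4 \<le> total_degree n d" and n: "0 < n" "n \<le> total_degree n d"
    and F: "\<And>x. 0 \<le> F x" "\<And>x. F x \<le> 1"
  shows "measure_pmf.expectation (pmf_of_set (pairings (stubs n d))) (pairing_error n M k F d)
    \<le> sqrt (20 / real n) + (real k + 2 * real M + 2)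
        * (2 * sb_average n d (\<lambda>x. of_bool (M' < x)) + (2 * real M' + 6 * (real M')\<^sup>2) / real n)"
proof -
  let ?p = "pmf_of_set (pairings (stubs n d))"
  define l where "l = real (total_degree n d)"
  define K where "K = real k + 2 * real M + 2"
  define E where "E = (\<lambda>P. l - real (total_degree n (erased_degree n P)))"
  have l: "0 < l" "real n \<le> l" using L n by (auto simp: l_def)
  have int: "integrable (measure_pmf ?p) f" for f :: "_ \<Rightarrow> real"
    using ev by (intro integrable_pairings) (auto simp: card_stubs)
  have "measure_pmf.expectation ?p (\<lambda>P. \<bar>E P\<bar>) = measure_pmf.expectation ?p E"
  proof (intro integral_cong_AE AE_pmfI)
    fix P assume "P \<in> set_pmf ?p"
    then have P: "P \<in> pairings (stubs n d)"
      using ev by (simp add: finite_pairings pairings_nonempty card_stubs)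
    have "total_degree n (erased_degree n P) \<le> total_degree n d"
      unfolding total_degree_def by (intro sum_mono erased_degree_le[OF P])
    then show "\<bar>E P\<bar> = E P" by (simp add: E_def l_def)
  qed simp_all
  also have "\<dots> \<le> 2 * (\<Sum>i=1..n. real (d i) * of_bool (M' < d i)) + 2 * real M' + 6 * (real M')\<^sup>2"
    unfolding E_def l_def by (rule expectation_erased_le[OF ev L])
  finally have "measure_pmf.expectation ?p (\<lambda>P. \<bar>E P\<bar>) / l
      \<le> (2 * (\<Sum>i=1..n. real (d i) * of_bool (M' < d i)) + 2 * real M' + 6 * (real M')\<^sup>2) / l"
    using l by (intro divide_right_mono) auto
  also have "\<dots> = 2 * sb_average n d (\<lambda>x. of_bool (M' < x)) + (2 * real M' + 6 * (real M')\<^sup>2) / l"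
    by (simp only: sb_average_def l_def add_divide_distrib times_divide_eq_right add.assoc)
  also have "(2 * real M' + 6 * (real M')\<^sup>2) / l \<le> (2 * real M' + 6 * (real M')\<^sup>2) / real n"
    using l n by (intro divide_left_mono) auto
  finally have 1: "measure_pmf.expectation ?p (\<lambda>P. \<bar>E P\<bar>) / l
      \<le> 2 * sb_average n d (\<lambda>x. of_bool (M' < x)) + (2 * real M' + 6 * (real M')\<^sup>2) / real n"
    by simp
  have "sqrt (20 / l) \<le> sqrt (20 / real n)"
    using l n by (intro real_sqrt_le_mono divide_left_mono) auto
  then have 2: "measure_pmf.expectation ?p (\<lambda>P. \<bar>rank_sum n k F d P / l
      - sb_average n d (\<lambda>x. of_bool (x = k)) * sb_average n d F\<bar>) \<le> sqrt (20 / real n)"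
    using expectation_rank_sum_close[where F = F and k = k, OF ev L F] unfolding l_def by linarith
  have "measure_pmf.expectation ?p (pairing_error n M k F d)
      = measure_pmf.expectation ?p (\<lambda>P. \<bar>rank_sum n k F d P / l
      - sb_average n d (\<lambda>x. of_bool (x = k)) * sb_average n d F\<bar>)
      + K * (measure_pmf.expectation ?p (\<lambda>P. \<bar>E P\<bar>) / l)"
    unfolding pairing_error_def[abs_def] K_def[symmetric] l_def[symmetric]
    by (subst Bochner_Integration.integral_add[OF int int]) (simp add: E_def)
  also have "\<dots> \<le> sqrt (20 / real n)
      + K * (2 * sb_average n d (\<lambda>x. of_bool (M' < x)) + (2 * real M' + 6 * (real M')\<^sup>2) / real n)"
    using 1 2 by (intro add_mono mult_left_mono) (auto simp: K_def)
  finally show ?thesis unfolding K_def .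
qed

lemma integrable_sb_average:
  assumes "\<And>x. 0 \<le> \<psi> x" "\<And>x. \<psi> x \<le> 1"
  shows "integrable (measure_pmf p) (\<lambda>d. sb_average n d \<psi>)"
  by (intro measure_pmf.integrable_const_bound[where B = 1])
    (use sb_average_bounds[where \<psi> = \<psi>, OF assms] in auto)

lemma erased_annr_tendsto:
  assumes int: "integrable (measure_pmf D) real" and D0: "0 \<notin> set_pmf D"
    and \<delta>: "0 < \<delta>" and k: "0 < size_biased_density D k"
  shows "(\<lambda>n. measure_pmf.prob (configuration_model D n)
      {(d, P). \<delta> < \<bar>erased_annr n P k
        - measure_pmf.expectation (size_biased_pmf D) (size_biased_cdf D)\<bar>}) \<longlonglongrightarrow> 0"
    (is "?Pr \<longlonglongrightarrow> 0")
proof -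
  define F where "F = size_biased_cdf D"
  define p where "p = size_biased_density D k"
  define c where "c = measure_pmf.expectation (size_biased_pmf D) F"
  \<comment> \<open>Below the first value \<open>erased_annr_close\<close> applies; below the second
    its bound \<open>4 * Z / p\<close> is less than \<open>\<delta>\<close>. Markov's inequality is
    used at this threshold.\<close>
  define \<eta> where "\<eta> = min (p / 2) (\<delta> * p / 4)"
  define r where "r = (\<lambda>\<psi> n. measure_pmf.expectation (iid_degrees D n)
      (\<lambda>d. \<bar>sb_average n d \<psi> - measure_pmf.expectation (size_biased_pmf D) \<psi>\<bar>))"
  have F: "mono F" "\<And>x. 0 \<le> F x" "\<And>x. F x \<le> 1"
    unfolding F_def using mono_size_biased_cdf size_biased_cdf_nonneg size_biased_cdf_le_1 int D0 by blast+
  have Fle: "measure_pmf.expectation (size_biased_pmf D) (\<lambda>x. of_bool (x \<le> m)) = F m"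
    and Fgt: "measure_pmf.expectation (size_biased_pmf D) (\<lambda>x. of_bool (m < x)) = 1 - F m" for m
    unfolding F_def by (rule expectation_size_biased_le[OF int D0] expectation_size_biased_gt[OF int D0])+
  have Feq: "measure_pmf.expectation (size_biased_pmf D) (\<lambda>x. of_bool (x = k)) = p"
    unfolding p_def by (rule expectation_size_biased_eq[OF int D0])
  have expb: "0 \<le> measure_pmf.expectation (size_biased_pmf D) \<psi>"
    "measure_pmf.expectation (size_biased_pmf D) \<psi> \<le> 1"
    if "\<And>x. 0 \<le> \<psi> x" "\<And>x. \<psi> x \<le> 1" for \<psi> :: "nat \<Rightarrow> real"
  proof -
    show "0 \<le> measure_pmf.expectation (size_biased_pmf D) \<psi>"
      using that by (simp add: Bochner_Integration.integral_nonneg)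
    have "integrable (measure_pmf (size_biased_pmf D)) \<psi>"
      using that by (intro measure_pmf.integrable_const_bound[where B = 1]) auto
    then have "measure_pmf.expectation (size_biased_pmf D) \<psi> \<le> measure_pmf.expectation (size_biased_pmf D) (\<lambda>_. 1)"
      using that by (intro integral_mono) auto
    then show "measure_pmf.expectation (size_biased_pmf D) \<psi> \<le> 1" by simp
  qed
  have p: "0 < p" "p \<le> 1" using k expb(2)[of "\<lambda>x. of_bool (x = k)"] Feq by (auto simp: p_def)
  have c: "0 \<le> c" "c \<le> 1" using expb[of F] F(2,3) by (auto simp: c_def)
  have k0: "0 < k" using k by (auto simp: size_biased_density_def intro!: gr0I)
  have \<eta>: "0 < \<eta>" using p \<delta> by (simp add: \<eta>_def)
  have r0: "r \<psi> \<longlonglongrightarrow> 0" if "\<And>x. 0 \<le> \<psi> x" "\<And>x. \<psi> x \<le> 1" for \<psi>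
    unfolding r_def using that by (intro sb_average_tendsto[OF int D0])
  \<comment> \<open>Expected total error: fluctuation of the pairing, erased stubs truncated at
    \<open>M'\<close>, and degree errors truncated at \<open>M\<close>. As \<open>n\<close> grows,
    only multiples of \<open>1 - F M'\<close> and \<open>1 - F M\<close> survive.\<close>
  define \<beta> where "\<beta> = (\<lambda>M M' n. sqrt (20 / real n)
      + (real k + 2 * real M + 2) * (2 * (r (\<lambda>x. of_bool (M' < x)) n + (1 - F M'))
          + (2 * real M' + 6 * (real M')\<^sup>2) / real n)
      + (r (\<lambda>x. of_bool (x = k)) n + r F n + 3 * (r (\<lambda>x. of_bool (M < x)) n + (1 - F M))
      + (\<Sum>m\<le>M. r (\<lambda>x. of_bool (x \<le> m)) n) + (1 - F M)))"
  have bound: "?Pr n \<le> \<beta> M M' n / \<eta>" if n: "4 \<le> n" for n M M'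
  proof -
    let ?I = "measure_pmf (iid_degrees D n)"
    define Z where "Z = (\<lambda>(d, P). pairing_error n M k F d P + degree_error n M k F p c d)"
    define B where "B = (\<lambda>d. sqrt (20 / real n) + (real k + 2 * real M + 2)
        * (2 * sb_average n d (\<lambda>x. of_bool (M' < x)) + (2 * real M' + 6 * (real M')\<^sup>2) / real n)
        + degree_error n M k F p c d)"
    let ?q = "\<lambda>d. map_pmf (Pair d) (pmf_of_set (pairings (stubs n d)))"
    have cm: "configuration_model D n = bind_pmf (iid_degrees D n) ?q"
      by (simp add: configuration_model_def map_pmf_def)
    have supp: "even (total_degree n d)" "4 \<le> total_degree n d" "n \<le> total_degree n d"
      if "d \<in> set_pmf (iid_degrees D n)" for d
      using set_pmf_iid_degrees[OF D0 that] n by auto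
    have intP: "integrable (measure_pmf (pmf_of_set (pairings (stubs n d)))) f"
      if "d \<in> set_pmf (iid_degrees D n)" for d and f :: "_ \<Rightarrow> real"
      using supp(1)[OF that] by (intro integrable_pairings) (auto simp: card_stubs)
    have iavg: "integrable ?I (\<lambda>d. sb_average n d \<psi>)"
      "integrable ?I (\<lambda>d. \<bar>sb_average n d \<psi> - x\<bar>)"
      if "\<And>x. 0 \<le> \<psi> x" "\<And>x. \<psi> x \<le> 1" for \<psi> x
      using integrable_sb_average[where \<psi> = \<psi>, OF that] by auto
    have ideg: "integrable ?I (degree_error n M k F p c)"
      unfolding degree_error_def[abs_def] using F(2,3)
      by (intro Bochner_Integration.integrable_add Bochner_Integration.integrable_sum iavg
          integrable_mult_right) auto
    have iB: "integrable ?I B"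
      unfolding B_def using ideg iavg(1)[of "\<lambda>x. of_bool (M' < x)"] by auto
    have deg0: "0 \<le> degree_error n M k F p c d" for d
      using sb_average_bounds(1)[of "\<lambda>x. of_bool (M < x)" n d] F(3)[of M]
      by (auto simp: degree_error_def intro!: add_nonneg_nonneg sum_nonneg)
    have Z0: "0 \<le> Z x" for x
      using deg0 by (auto simp: Z_def pairing_error_def intro!: add_nonneg_nonneg split: prod.split)
    have condZ: "measure_pmf.expectation (?q d) Z \<le> B d" if d: "d \<in> set_pmf (iid_degrees D n)" for d
    proof -
      have "measure_pmf.expectation (?q d) Z
        = measure_pmf.expectation (pmf_of_set (pairings (stubs n d))) (pairing_error n M k F d)
          + degree_error n M k F p c d"
        by (simp add: Z_def intP[OF d])
      then show ?thesis
        using expectation_pairing_error_le[where F = F and M = M and k = k and M' = M', OF supp(1,2)[OF d] _ supp(3)[OF d] F(2,3)] n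
        unfolding B_def by simp
    qed
    have iZ: "integrable (measure_pmf (configuration_model D n)) Z"
      and EZ: "measure_pmf.expectation (configuration_model D n) Z \<le> measure_pmf.expectation (iid_degrees D n) B"
      unfolding cm
      using expectation_bind_pmf_le[where b = B and q = ?q, OF _ Z0 condZ iB] intP by simp_all
    have avg_le: "measure_pmf.expectation (iid_degrees D n) (\<lambda>d. sb_average n d (\<lambda>x. of_bool (m < x)))
        \<le> r (\<lambda>x. of_bool (m < x)) n + (1 - F m)" for m
    proof -
      have "measure_pmf.expectation (iid_degrees D n) (\<lambda>d. sb_average n d (\<lambda>x. of_bool (m < x)))
        \<le> measure_pmf.expectation (iid_degrees D n)
          (\<lambda>d. \<bar>sb_average n d (\<lambda>x. of_bool (m < x)) - (1 - F m)\<bar> + (1 - F m))"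
        by (intro integral_mono iavg Bochner_Integration.integrable_add) auto
      also have "\<dots> = r (\<lambda>x. of_bool (m < x)) n + (1 - F m)"
        unfolding r_def Fgt by (subst Bochner_Integration.integral_add) (auto intro!: iavg)
      finally show ?thesis .
    qed
    have Edeg: "measure_pmf.expectation (iid_degrees D n) (degree_error n M k F p c)
        \<le> r (\<lambda>x. of_bool (x = k)) n + r F n + 3 * (r (\<lambda>x. of_bool (M < x)) n + (1 - F M))
          + (\<Sum>m\<le>M. r (\<lambda>x. of_bool (x \<le> m)) n) + (1 - F M)"
    proof -
      note ints = iavg[of "\<lambda>x. of_bool (x = k)"] iavg[of F, OF F(2,3)]
        iavg[of "\<lambda>x. of_bool (M < x)"] iavg(2)[of "\<lambda>x. of_bool (x \<le> m)" for m]
      have "measure_pmf.expectation (iid_degrees D n) (degree_error n M k F p c)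
        = r (\<lambda>x. of_bool (x = k)) n + r F n
          + 3 * measure_pmf.expectation (iid_degrees D n) (\<lambda>d. sb_average n d (\<lambda>x. of_bool (M < x)))
          + (\<Sum>m\<le>M. r (\<lambda>x. of_bool (x \<le> m)) n) + (1 - F M)"
        unfolding degree_error_def[abs_def] r_def Fle Feq c_def[symmetric]
        by (simp add: ints Bochner_Integration.integral_add Bochner_Integration.integral_sum)
      also have "\<dots> \<le> r (\<lambda>x. of_bool (x = k)) n + r F n + 3 * (r (\<lambda>x. of_bool (M < x)) n + (1 - F M))
          + (\<Sum>m\<le>M. r (\<lambda>x. of_bool (x \<le> m)) n) + (1 - F M)"
        by (intro add_mono mult_left_mono avg_le order_refl) simp
      finally show ?thesis .
    qed
    have "measure_pmf.expectation (iid_degrees D n) B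
        = sqrt (20 / real n) + (real k + 2 * real M + 2)
          * (2 * measure_pmf.expectation (iid_degrees D n) (\<lambda>d. sb_average n d (\<lambda>x. of_bool (M' < x)))
            + (2 * real M' + 6 * (real M')\<^sup>2) / real n)
          + measure_pmf.expectation (iid_degrees D n) (degree_error n M k F p c)"
      unfolding B_def using ideg iavg(1)[of "\<lambda>x. of_bool (M' < x)"]
      by (simp add: Bochner_Integration.integral_add)
    also have "\<dots> \<le> \<beta> M M' n"
      unfolding \<beta>_def
      by (intro add_mono mult_left_mono Edeg avg_le order_refl) auto
    finally have EB: "measure_pmf.expectation (iid_degrees D n) B \<le> \<beta> M M' n" .
    have "?Pr n \<le> measure_pmf.prob (configuration_model D n) {x. \<eta> \<le> Z x}"
    proof (rule measure_pmf.finite_measure_mono_AE, rule AE_pmfI, rule impI)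
      fix x assume x: "x \<in> set_pmf (configuration_model D n)"
        and ev: "x \<in> {(d, P). \<delta> < \<bar>erased_annr n P k
          - measure_pmf.expectation (size_biased_pmf D) (size_biased_cdf D)\<bar>}"
      obtain d P where dP: "x = (d, P)" by (cases x)
      have d: "d \<in> set_pmf (iid_degrees D n)"
        using x unfolding cm dP by auto
      then have P: "P \<in> pairings (stubs n d)"
        using x supp(1)[OF d] unfolding cm dP
        by (auto simp: finite_pairings pairings_nonempty card_stubs)
      have L: "0 < total_degree n d" using supp(2)[OF d] by simp
      have gt: "\<delta> < \<bar>erased_annr n P k - c\<bar>"
        using ev unfolding dP c_def F_def by simp
      have "\<eta> \<le> Z (d, P)"
      proof (rule ccontr)
        assume "\<not> \<eta> \<le> Z (d, P)"
        then have lt: "Z (d, P) < p / 2" "Z (d, P) < \<delta> * p / 4"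
          by (auto simp: \<eta>_def)
        have "\<bar>erased_annr n P k - c\<bar> \<le> 4 * Z (d, P) / p"
          using erased_annr_close[OF P L k0 F p c, of M] lt(1) by (simp add: Z_def)
        also have "\<dots> < \<delta>"
          using lt(2) p by (simp add: field_simps)
        finally show False using gt by simp
      qed
      then show "x \<in> {x. \<eta> \<le> Z x}" by (simp add: dP)
    qed simp
    also have "\<dots> \<le> measure_pmf.expectation (configuration_model D n) Z / \<eta>"
      using integral_Markov_inequality_measure[OF iZ _ _ \<eta>, of UNIV] Z0 by simp
    also have "\<dots> \<le> \<beta> M M' n / \<eta>"
      using EZ EB \<eta> by (intro divide_right_mono) auto
    finally show ?thesis .
  qed
  have \<beta>lim: "\<beta> M M' \<longlonglongrightarrow> (real k + 2 * real M + 2) * (2 * (1 - F M')) + 4 * (1 - F M)" for M M'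
  proof -
    have div: "(\<lambda>n. x / real n) \<longlonglongrightarrow> 0" for x
      by (intro real_tendsto_divide_at_top[OF tendsto_const] filterlim_real_sequentially)
    have "(\<lambda>n. sqrt (20 / real n)) \<longlonglongrightarrow> sqrt 0"
      by (intro tendsto_real_sqrt div)
    moreover have "(\<lambda>n. \<Sum>m\<le>M. r (\<lambda>x. of_bool (x \<le> m)) n) \<longlonglongrightarrow> (\<Sum>m\<le>M. 0)"
      by (intro tendsto_sum r0) auto
    ultimately have "\<beta> M M' \<longlonglongrightarrow> sqrt 0 + (real k + 2 * real M + 2) * (2 * (0 + (1 - F M')) + 0)
        + (0 + 0 + 3 * (0 + (1 - F M)) + (\<Sum>m\<le>M. 0) + (1 - F M))"
      unfolding \<beta>_def using F(2,3)
      by (intro tendsto_add tendsto_mult tendsto_const r0 div) auto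
    then show ?thesis by simp
  qed
  have tail: "\<exists>M. x * (1 - F M) < y" if "0 < y" for x y
  proof -
    have "(\<lambda>M. x * (1 - F M)) \<longlonglongrightarrow> x * (1 - 1)"
      unfolding F_def by (intro tendsto_intros size_biased_cdf_tendsto[OF int D0])
    then have "eventually (\<lambda>M. x * (1 - F M) < y) sequentially"
      using that by (intro order_tendstoD(2)) auto
    then show ?thesis by (auto simp: eventually_sequentially)
  qed
  show ?thesis
  proof (rule LIMSEQ_I)
    fix e :: real assume e: "0 < e"
    \<comment> \<open>The coefficient of \<open>1 - F M'\<close> grows with \<open>M\<close>, so
      \<open>M\<close> is fixed first and \<open>M'\<close> depends on it. The factor 4 consists of
      the three occurrences of the tail of stubs and the tail of \<open>F\<close> itself.\<close>
    obtain M where M: "4 * (1 - F M) < e * \<eta> / 2"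
      using tail[of "e * \<eta> / 2" 4] e \<eta> by auto
    obtain M' where M': "((real k + 2 * real M + 2) * 2) * (1 - F M') < e * \<eta> / 2"
      using tail[of "e * \<eta> / 2" "(real k + 2 * real M + 2) * 2"] e \<eta> by auto
    have "(real k + 2 * real M + 2) * (2 * (1 - F M')) + 4 * (1 - F M) < e * \<eta>"
      using M M' by (simp only: mult.assoc)
    then have "eventually (\<lambda>n. \<beta> M M' n < e * \<eta>) sequentially"
      using order_tendstoD(2)[OF \<beta>lim] by blast
    then have "eventually (\<lambda>n. norm (?Pr n - 0) < e) sequentially"
      using eventually_ge_at_top[of 4]
    proof eventually_elim
      case (elim n)
      have "?Pr n < e"
        using bound[OF elim(2), of M M'] elim(1) \<eta> by (smt (verit) divide_less_eq)
      then show ?case by simp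
    qed
    then show "\<exists>n0. \<forall>n\<ge>n0. norm (?Pr n - 0) < e"
      by (simp add: eventually_sequentially)
  qed
qed

theorem theorem6p5:
  fixes D :: "nat pmf" and \<gamma> \<delta> :: real and k :: nat
  assumes "0 \<notin> set_pmf D"
    and "\<gamma> > 1"
    and "regularly_varying D \<gamma>"
    and "\<delta> > 0"
    and "size_biased_density D k > 0"
  shows "(\<lambda>n. measure_pmf.prob (configuration_model D n)
            {(d, P). \<bar>erased_annr n P k
                       - measure_pmf.expectation (size_biased_pmf D) (size_biased_cdf D)\<bar>
                     * of_bool (empirical_density n d k > 0) > \<delta>})
         \<longlonglongrightarrow> 0"
proof (rule tendsto_sandwich[OF _ _ tendsto_const])
  let ?c = "measure_pmf.expectation (size_biased_pmf D) (size_biased_cdf D)"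
  show "(\<lambda>n. measure_pmf.prob (configuration_model D n)
      {(d, P). \<delta> < \<bar>erased_annr n P k - ?c\<bar>}) \<longlonglongrightarrow> 0"
    using assms by (intro erased_annr_tendsto regularly_varying_integrable)
  \<comment> \<open>Where the indicator vanishes the product is 0 and cannot exceed the positive
    \<open>\<delta>\<close>; elsewhere the two conditions agree.\<close>
  have "{(d, P). \<bar>erased_annr n P k - ?c\<bar> * of_bool (empirical_density n d k > 0) > \<delta>}
      \<subseteq> {(d, P). \<delta> < \<bar>erased_annr n P k - ?c\<bar>}" for n
    using assms(4) by (auto simp: of_bool_def split: if_splits)
  then show "\<forall>\<^sub>F n in sequentially. measure_pmf.prob (configuration_model D n)
      {(d, P). \<bar>erased_annr n P k - ?c\<bar> * of_bool (empirical_density n d k > 0) > \<delta>}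
    \<le> measure_pmf.prob (configuration_model D n) {(d, P). \<delta> < \<bar>erased_annr n P k - ?c\<bar>}"
    by (intro always_eventually allI measure_pmf.finite_measure_mono) auto
qed simp

end
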